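(* Let $k$ be a field, let $T$ be a tree, let $\phi$ be any function from the set of red-green components of $T$ to $\{\mathtt{generic},\mathtt{versal}\}$, let $M$ be a maximum matching of $T$, and fix invertible parameters in $k$ on the vertices not covered by $M$ of the generic components, satisfying the genericity condition. Then the variety $X^\phi_T$ over $k$ is smooth.
   Context: A tree is a finite connected simply-connected graph. A vertex cover of a tree $T$ is a set of vertices meeting every edge; a minimum vertex cover is one of minimal cardinality. Canonical coloring: a vertex of $T$ is green if it lies in all minimum vertex covers, orange if it lies in some but not all minimum vertex covers, red if it lies in none. A matching of $T$ is a set of edges (called dominoes) such that every vertex lies in at most one of them; a maximum matching is one of maximal cardinality. Known fact: every maximum matching covers all orange and green vertices, so uncovered vertices are red. The red-green components of $T$ are the connected components of the graph whose vertices are the red and green vertices of $T$ and whose edges are the edges of $T$ with one red end and one green end. Varieties: given $T$, a function $\phi$ from the set of red-green components of $T$ to $\{\mathtt{generic},\mathtt{versal}\}$, a maximum matching $M$, and for every component $C$ with $\phi(C)=\mathtt{generic}$ and every vertex $u$ of $C$ not covered by $M$ a fixed value $\alpha_u\in k^\times$, $X^\phi_T$ is the affine scheme over $k$ with variables $x_i,x'_i$ for all vertices $i$ of $T$ and $\alpha_i$ for all vertices $i$ not covered by $M$ lying in components $C$ with $\phi(C)=\mathtt{versal}$, defined by the equations $x_ix'_i=1+\alpha_i\prod_{j} x_j$ for all vertices $i$ (product over the vertices $j$ adjacent to $i$) and the condition that all variables $\alpha_i$ are invertible; here $\alpha_i=1$ whenever $i$ is covered by $M$. Genericity condition (always assumed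 for every generic component $C$): a non-empty set $S$ of red vertices of $C$ is admissible if every green vertex of $C$ has either $0$ or $2$ neighbors in $S$. For every admissible set $S$ and every choice of signs $\varepsilon:S\to\{1,-1\}$ such that two distinct elements of $S$ sharing a common green neighbor have opposite signs, one requires $\prod_{i\in S}\alpha_i^{\varepsilon_i}\neq(-1)^{\#S}$. *)

theory Defs
  imports "HOL-Algebra.QuotRing" "HOL-Library.Poly_Mapping"
begin

section \<open>Trees, vertex covers, matchings\<close>

definition simple_graph :: "'a set \<Rightarrow> 'a set set \<Rightarrow> bool" where
  "simple_graph V E \<longleftrightarrow> finite V \<and> (\<forall>e\<in>E. e \<subseteq> V \<and> card e = 2)"

definition connected_graph :: "'a set \<Rightarrow> 'a set set \<Rightarrow> bool" where
  "connected_graph V E \<longleftrightarrow>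
     V \<noteq> {} \<and> (\<forall>u\<in>V. \<forall>v\<in>V. (u, v) \<in> {(a, b). {a, b} \<in> E}\<^sup>*)"

definition is_cycle :: "'a set set \<Rightarrow> 'a list \<Rightarrow> bool" where
  "is_cycle E c \<longleftrightarrow> 3 \<le> length c \<and> distinct c \<and>
     (\<forall>i < length c. {c ! i, c ! (Suc i mod length c)} \<in> E)"

text \<open>For a graph, simple connectedness means absence of cycles; loops and
  multiple edges are cycles too, which is why trees are simple graphs.\<close>

definition tree :: "'a set \<Rightarrow> 'a set set \<Rightarrow> bool" where
  "tree V E \<longleftrightarrow> simple_graph V E \<and> connected_graph V E \<and> (\<nexists>c. is_cycle E c)"

definition neighbors :: "'a set set \<Rightarrow> 'a \<Rightarrow> 'a set" where
  "neighbors E v = {u. {u, v} \<in> E}"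

definition vertex_cover :: "'a set \<Rightarrow> 'a set set \<Rightarrow> 'a set \<Rightarrow> bool" where
  "vertex_cover V E C \<longleftrightarrow> C \<subseteq> V \<and> (\<forall>e\<in>E. e \<inter> C \<noteq> {})"

definition minimum_vertex_cover :: "'a set \<Rightarrow> 'a set set \<Rightarrow> 'a set \<Rightarrow> bool" where
  "minimum_vertex_cover V E C \<longleftrightarrow>
     vertex_cover V E C \<and> (\<forall>D. vertex_cover V E D \<longrightarrow> card C \<le> card D)"

definition green :: "'a set \<Rightarrow> 'a set set \<Rightarrow> 'a set" where
  "green V E = {v\<in>V. \<forall>C. minimum_vertex_cover V E C \<longrightarrow> v \<in> C}"

definition red :: "'a set \<Rightarrow> 'a set set \<Rightarrow> 'a set" where
  "red V E = {v\<in>V. \<forall>C. minimum_vertex_cover V E C \<longrightarrow> v \<notin> C}"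

definition matching :: "'a set set \<Rightarrow> 'a set set \<Rightarrow> bool" where
  "matching E M \<longleftrightarrow> M \<subseteq> E \<and> (\<forall>e\<in>M. \<forall>f\<in>M. e \<noteq> f \<longrightarrow> e \<inter> f = {})"

definition maximum_matching :: "'a set set \<Rightarrow> 'a set set \<Rightarrow> bool" where
  "maximum_matching E M \<longleftrightarrow>
     matching E M \<and> (\<forall>N. matching E N \<longrightarrow> card N \<le> card M)"


section \<open>Red-green components and the genericity condition\<close>

definition red_green_adj :: "'a set \<Rightarrow> 'a set set \<Rightarrow> ('a \<times> 'a) set" where
  "red_green_adj V E = {(u, v). {u, v} \<in> E \<and>
     (u \<in> red V E \<and> v \<in> green V E \<or> u \<in> green V E \<and> v \<in> red V E)}"

text \<open>A component is represented by its set of vertices.\<close>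

definition red_green_components :: "'a set \<Rightarrow> 'a set set \<Rightarrow> 'a set set" where
  "red_green_components V E =
     {{w. (v, w) \<in> (red_green_adj V E)\<^sup>*} | v. v \<in> red V E \<union> green V E}"

datatype component_type = Generic | Versal

text \<open>The parameter \<open>\<alpha>\<^sub>u\<close> with the convention that it is \<open>1\<close> on covered vertices.\<close>

definition param :: "'a set set \<Rightarrow> ('a \<Rightarrow> 'k::field) \<Rightarrow> 'a \<Rightarrow> 'k" where
  "param M \<alpha> u = (if u \<in> \<Union>M then 1 else \<alpha> u)"

definition admissible :: "'a set \<Rightarrow> 'a set set \<Rightarrow> 'a set \<Rightarrow> 'a set \<Rightarrow> bool" where
  "admissible V E C S \<longleftrightarrow> S \<noteq> {} \<and> S \<subseteq> C \<inter> red V E \<and>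
     (\<forall>g \<in> C \<inter> green V E. card (neighbors E g \<inter> S) \<in> {0, 2})"

definition admissible_signs :: "'a set \<Rightarrow> 'a set set \<Rightarrow> 'a set \<Rightarrow> ('a \<Rightarrow> int) \<Rightarrow> bool" where
  "admissible_signs V E S \<epsilon> \<longleftrightarrow> (\<forall>i\<in>S. \<epsilon> i \<in> {1, -1}) \<and>
     (\<forall>i\<in>S. \<forall>j\<in>S. i \<noteq> j \<and> neighbors E i \<inter> neighbors E j \<inter> green V E \<noteq> {} \<longrightarrow> \<epsilon> j = - \<epsilon> i)"

definition genericity_condition ::
    "'a set \<Rightarrow> 'a set set \<Rightarrow> 'a set set \<Rightarrow> ('a \<Rightarrow> 'k::field) \<Rightarrow> 'a set \<Rightarrow> bool" where
  "genericity_condition V E M \<alpha> C \<longleftrightarrow>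
     (\<forall>S \<epsilon>. admissible V E C S \<and> admissible_signs V E S \<epsilon> \<longrightarrow>
        (\<Prod>i\<in>S. param M \<alpha> i powi \<epsilon> i) \<noteq> (-1) ^ card S)"


section \<open>Algebras over a field and smoothness\<close>

text \<open>The ground ring is a type; algebras over it are rings in the sense of HOL-Algebra
  together with a structure homomorphism.\<close>

definition base_ring :: "'k::comm_ring_1 ring" where
  "base_ring = \<lparr>carrier = UNIV, monoid.mult = (*), one = 1, ring.zero = 0, add = (+)\<rparr>"

definition is_algebra :: "'b ring \<Rightarrow> ('k::comm_ring_1 \<Rightarrow> 'b) \<Rightarrow> bool" where
  "is_algebra B \<theta> \<longleftrightarrow> cring B \<and> \<theta> \<in> ring_hom base_ring B"

definition algebra_hom ::
    "'b ring \<Rightarrow> ('k::comm_ring_1 \<Rightarrow> 'b) \<Rightarrow> 'c ring \<Rightarrow> ('k \<Rightarrow> 'c) \<Rightarrow> ('b \<Rightarrow> 'c) set" where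
  "algebra_hom A \<eta> B \<theta> = {h \<in> ring_hom A B. \<forall>c. h (\<eta> c) = \<theta> c}"

type_synonym ('v, 'k) mpoly = "('v \<Rightarrow>\<^sub>0 nat) \<Rightarrow>\<^sub>0 'k"

definition mpoly_var :: "'v \<Rightarrow> ('v, 'k::comm_ring_1) mpoly" where
  "mpoly_var v = Poly_Mapping.single (Poly_Mapping.single v 1) 1"

definition mpoly_const :: "'k \<Rightarrow> ('v, 'k::comm_ring_1) mpoly" where
  "mpoly_const c = Poly_Mapping.single 0 c"

text \<open>The polynomial ring over \<open>'k\<close> in the variables belonging to the set \<open>Vs\<close>.\<close>

definition mpoly_ring :: "'v set \<Rightarrow> ('v, 'k::comm_ring_1) mpoly ring" where
  "mpoly_ring Vs = \<lparr>carrier = {p. \<forall>m \<in> Poly_Mapping.keys p. Poly_Mapping.keys m \<subseteq> Vs},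
     monoid.mult = (*), one = 1, ring.zero = 0, add = (+)\<rparr>"

definition finitely_presented :: "'b ring \<Rightarrow> ('k::comm_ring_1 \<Rightarrow> 'b) \<Rightarrow> bool" where
  "finitely_presented A \<eta> \<longleftrightarrow>
     (\<exists>(n::nat) h F. h \<in> algebra_hom (mpoly_ring {..<n}) mpoly_const A \<eta> \<and>
        h ` carrier (mpoly_ring {..<n}) = carrier A \<and>
        finite F \<and> F \<subseteq> carrier (mpoly_ring {..<n}) \<and>
        a_kernel (mpoly_ring {..<n}) A h = Idl\<^bsub>mpoly_ring {..<n}\<^esub> F)"

text \<open>Formal smoothness: for every algebra \<open>B\<close> and every ideal \<open>J\<close> of \<open>B\<close> of square zero, every
  algebra homomorphism to \<open>B / J\<close> lifts to \<open>B\<close>. HOL cannot quantify over types inside a formula,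
  so the type \<open>'b\<close> of the elements of \<open>B\<close> is a parameter; the notion proper is the one with
  \<open>'b\<close> universally quantified, i.e. a type variable occurring nowhere else in the theorem.\<close>

definition formally_smooth :: "'b itself \<Rightarrow> 'a ring \<Rightarrow> ('k::comm_ring_1 \<Rightarrow> 'a) \<Rightarrow> bool" where
  "formally_smooth _ A \<eta> \<longleftrightarrow>
     (\<forall>(B :: 'b ring) \<theta> J g.
        is_algebra B \<theta> \<and> ideal J B \<and> (\<forall>x\<in>J. \<forall>y\<in>J. x \<otimes>\<^bsub>B\<^esub> y = \<zero>\<^bsub>B\<^esub>) \<and>
        g \<in> algebra_hom A \<eta> (B Quot J) (\<lambda>c. J +>\<^bsub>B\<^esub> \<theta> c) \<longrightarrow>
        (\<exists>h \<in> algebra_hom A \<eta> B \<theta>. \<forall>a \<in> carrier A. J +>\<^bsub>B\<^esub> h a = g a))"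

text \<open>Smoothness of the affine scheme Spec \<open>A\<close> over \<open>'k\<close>, as in EGA IV, 17.3.1: formally smooth
  and (locally) of finite presentation.\<close>

definition smooth_algebra :: "'b itself \<Rightarrow> 'a ring \<Rightarrow> ('k::comm_ring_1 \<Rightarrow> 'a) \<Rightarrow> bool" where
  "smooth_algebra T A \<eta> \<longleftrightarrow>
     is_algebra A \<eta> \<and> finitely_presented A \<eta> \<and> formally_smooth T A \<eta>"


section \<open>The varieties\<close>

datatype 'a coord = Xvar 'a | Xvar' 'a | Alpha 'a | AlphaInv 'a

definition versal_uncovered ::
    "'a set \<Rightarrow> 'a set set \<Rightarrow> ('a set \<Rightarrow> component_type) \<Rightarrow> 'a set set \<Rightarrow> 'a set" where
  "versal_uncovered V E \<phi> M =
     {u\<in>V. u \<notin> \<Union>M \<and> (\<exists>C \<in> red_green_components V E. u \<in> C \<and> \<phi> C = Versal)}"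

text \<open>Invertibility of the variables \<open>\<alpha>\<^sub>i\<close> is expressed by the usual presentation of the
  localization: a further variable \<open>AlphaInv i\<close> and the relation
  \<open>Alpha i * AlphaInv i = 1\<close>.\<close>

definition coords ::
    "'a set \<Rightarrow> 'a set set \<Rightarrow> ('a set \<Rightarrow> component_type) \<Rightarrow> 'a set set \<Rightarrow> 'a coord set" where
  "coords V E \<phi> M = Xvar ` V \<union> Xvar' ` V \<union>
     Alpha ` versal_uncovered V E \<phi> M \<union> AlphaInv ` versal_uncovered V E \<phi> M"

definition coefficient ::
    "'a set \<Rightarrow> 'a set set \<Rightarrow> ('a set \<Rightarrow> component_type) \<Rightarrow> 'a set set \<Rightarrow> ('a \<Rightarrow> 'k::field) \<Rightarrow>
     'a \<Rightarrow> ('a coord, 'k) mpoly" where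
  "coefficient V E \<phi> M \<alpha> i =
     (if i \<in> versal_uncovered V E \<phi> M then mpoly_var (Alpha i) else mpoly_const (param M \<alpha> i))"

definition relations ::
    "'a set \<Rightarrow> 'a set set \<Rightarrow> ('a set \<Rightarrow> component_type) \<Rightarrow> 'a set set \<Rightarrow> ('a \<Rightarrow> 'k::field) \<Rightarrow>
     ('a coord, 'k) mpoly set" where
  "relations V E \<phi> M \<alpha> =
     {mpoly_var (Xvar i) * mpoly_var (Xvar' i)
        - (1 + coefficient V E \<phi> M \<alpha> i * (\<Prod>j\<in>neighbors E i. mpoly_var (Xvar j))) | i. i \<in> V} \<union>
     {mpoly_var (Alpha i) * mpoly_var (AlphaInv i) - 1 | i. i \<in> versal_uncovered V E \<phi> M}"

text \<open>The coordinate ring of the affine scheme \<open>X\<^sub>T\<^sup>\<phi>\<close> and its \<open>'k\<close>-algebra structure.\<close>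

definition coordinate_ring ::
    "'a set \<Rightarrow> 'a set set \<Rightarrow> ('a set \<Rightarrow> component_type) \<Rightarrow> 'a set set \<Rightarrow> ('a \<Rightarrow> 'k::field) \<Rightarrow>
     ('a coord, 'k) mpoly set ring" where
  "coordinate_ring V E \<phi> M \<alpha> =
     (let P = mpoly_ring (coords V E \<phi> M) in P Quot (Idl\<^bsub>P\<^esub> (relations V E \<phi> M \<alpha>)))"

definition structure_map ::
    "'a set \<Rightarrow> 'a set set \<Rightarrow> ('a set \<Rightarrow> component_type) \<Rightarrow> 'a set set \<Rightarrow> ('a \<Rightarrow> 'k::field) \<Rightarrow>
     'k \<Rightarrow> ('a coord, 'k) mpoly set" where
  "structure_map V E \<phi> M \<alpha> c =
     (let P = mpoly_ring (coords V E \<phi> M) in (Idl\<^bsub>P\<^esub> (relations V E \<phi> M \<alpha>)) +>\<^bsub>P\<^esub> mpoly_const c)"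

end

theory Submission
  imports Defs HOL.Modules
begin

text \<open>Let \<open>P\<close> be the polynomial ring and \<open>I\<close> the ideal of relations. Formal smoothness follows once
  \<open>P / I\<^sup>2 \<rightarrow> P / I\<close> splits, and a Newton step produces a splitting when the Jacobian of the vertex
  relations is surjective modulo \<open>I\<close>. If it is not, localize at a prime \<open>m \<supseteq> I\<close> in the support of
  the cokernel, and let \<open>S\<close> be the set of vertices whose unit vectors are not in the localized
  image. On \<open>S\<close> the variable \<open>x\<^sub>i\<close> lies in \<open>m\<close>, so \<open>\<alpha>\<^sub>i \<Prod>\<^sub>j x\<^sub>j = -1\<close> modulo \<open>m\<close>; the columns of the
  \<open>\<alpha>\<^sub>i\<close> keep the versal parameters out of \<open>S\<close>; and the column of \<open>x\<^sub>j\<close> shows that a neighbour \<open>j\<close> of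
  \<open>S\<close> has at least two neighbours in \<open>S\<close>. In a tree the last property forces every vertex of \<open>S\<close>
  to be red and to be joined to an uncovered vertex of \<open>S\<close> inside its red-green component, which
  is therefore generic, and it allows one to grow an admissible subset of \<open>S\<close> with alternating
  signs. Multiplying the relations over this subset contradicts the genericity condition.\<close>

section \<open>Vertex covers and alternating paths in trees\<close>

text \<open>Over an arbitrary field rational points may be too scarce for a pointwise Jacobian
  criterion. Failure of surjectivity is therefore detected at a prime ideal of the polynomial ring
  itself, and localization is expressed by factors outside \<open>m\<close> and congruences modulo
  \<open>I\<close>. Why two neighbours in \<open>S\<close>: modulo \<open>I\<close>,
  \<open>x j\<close> times the column of \<open>x j\<close> has the entry
  \<open>1 - x l * x' l\<close> at each neighbour \<open>l\<close> of \<open>j\<close>, which is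
  congruent to 1 modulo \<open>m\<close> when \<open>l\<close> is in \<open>S\<close>. The unit
  vectors at \<open>j\<close> and at neighbours outside \<open>S\<close> lie in the localized image
  anyway, so a single \<open>l\<close> in \<open>S\<close> would have its unit vector there as well.
  The matching enters through Koenig's theorem: a minimum cover has as many vertices as
  \<open>M\<close> has dominoes, so it meets each domino exactly once. A walk in which dominoes
  alternate with steps to a second neighbour in \<open>S\<close> can only stop at an uncovered
  vertex, and the colours are then read backwards along it. The relations for the inverses of the
  versal parameters stay out of the Jacobian, because the inverse can be corrected after the
  parameter.\<close>

lemma edge_in_vertices:
  assumes "tree V E" "{u, v} \<in> E"
  shows "u \<in> V" "v \<in> V" "u \<noteq> v"
  using assms unfolding tree_def simple_graph_def by force+

lemma card_2_other_element:
  assumes "card e = 2" "v \<in> e"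
  shows "\<exists>p. e = {p, v}"
  using assms by (auto simp: card_2_iff)

lemma edge_commute: "{u, v} \<in> E \<longleftrightarrow> {v, u} \<in> E"
  by (simp add: insert_commute)

section \<open>Depth functions on rooted trees and Koenig's theorem\<close>

lemma successively_is_cycle:
  assumes "3 \<le> length c" "distinct c" "successively (\<lambda>u v. {u, v} \<in> E) c" "{last c, hd c} \<in> E"
  shows "is_cycle E c"
  unfolding is_cycle_def
proof (intro conjI allI impI)
  fix i assume i: "i < length c"
  show "{c ! i, c ! (Suc i mod length c)} \<in> E"
  proof (cases "Suc i = length c")
    case True
    moreover have "c \<noteq> []" using assms(1) by auto
    ultimately have "c ! i = last c" "c ! (Suc i mod length c) = hd c"
      by (simp_all add: last_conv_nth hd_conv_nth flip: True)
    then show ?thesis using assms(4) by simp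
  next
    case False
    then show ?thesis using i assms(3) by (simp add: successively_conv_nth)
  qed
qed (use assms in auto)

text \<open>The parent of \<open>v\<close> is its neighbour of depth one less. No root or path is
  mentioned, so one function \<open>d\<close> for \<open>E\<close> serves every \<open>F\<close>
  contained in \<open>E\<close> in the induction for Koenig's theorem.\<close>

definition tree_depth :: "'a set set \<Rightarrow> ('a \<Rightarrow> nat) \<Rightarrow> bool" where
  "tree_depth E d \<longleftrightarrow>
     (\<forall>u v. {u, v} \<in> E \<longrightarrow> d u = Suc (d v) \<or> d v = Suc (d u)) \<and>
     (\<forall>u v w. {u, v} \<in> E \<longrightarrow> {w, v} \<in> E \<longrightarrow> d v = Suc (d u) \<longrightarrow> d v = Suc (d w) \<longrightarrow> u = w)"

lemma tree_depth_adjacent: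
  "tree_depth E d \<Longrightarrow> {u, v} \<in> E \<Longrightarrow> d u = Suc (d v) \<or> d v = Suc (d u)"
  unfolding tree_depth_def by blast

lemma tree_depth_parent_unique:
  "tree_depth E d \<Longrightarrow> {u, v} \<in> E \<Longrightarrow> {w, v} \<in> E \<Longrightarrow> d v = Suc (d u) \<Longrightarrow> d v = Suc (d w) \<Longrightarrow> u = w"
  unfolding tree_depth_def by blast

text \<open>The depth is the distance from the root: an edge within a level, or a second edge to the
  previous level, would close a cycle with two shortest paths to the root.\<close>

lemma tree_depth_exists:
  assumes T: "tree V E" and r: "r \<in> V"
  obtains d where "tree_depth E d" "d r = 0"
proof -
  let ?R = "{(a, b). {a, b} \<in> E}"
  define d where "d v = (LEAST n. (r, v) \<in> ?R ^^ n)" for v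
  have conn: "\<exists>n. (r, v) \<in> ?R ^^ n" if "v \<in> V" for v
    using T r that unfolding tree_def connected_graph_def by (meson rtrancl_imp_relpow)
  have dpath: "(r, v) \<in> ?R ^^ d v" if "v \<in> V" for v
    unfolding d_def using LeastI_ex[OF conn[OF that]] .
  have dle: "d v \<le> n" if "(r, v) \<in> ?R ^^ n" for v n
    unfolding d_def using that by (rule Least_le)
  have step: "d v \<le> Suc (d u)" if e: "{u, v} \<in> E" for u v
    using dpath[of u] edge_in_vertices[OF T e] e by (intro dle) auto
  have d0: "v = r" if "d v = 0" "v \<in> V" for v using dpath[OF that(2)] that(1) by simp
  have par: "\<exists>u. {u, v} \<in> E \<and> d u = n" if v: "v \<in> V" and n: "d v = Suc n" for v n
  proof -
    from dpath[OF v] n obtain u where u: "(r, u) \<in> ?R ^^ n" "{u, v} \<in> E" by auto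
    then have "d u \<le> n" "Suc n \<le> Suc (d u)" using dle step[of u v] n by auto
    then show ?thesis using u by auto
  qed
  \<comment> \<open>The depth bound keeps the list distinct: the next pair \<open>u\<close>,
    \<open>w\<close> lies one level deeper than everything already in \<open>c\<close>, and so does
    the vertex \<open>v\<close> that closes the cycle in \<open>uniq\<close>. At depth 0 there is
    only \<open>r\<close>.\<close>
  have path: "\<exists>c. 3 \<le> length c \<and> distinct c \<and> successively (\<lambda>u v. {u, v} \<in> E) c \<and>
      hd c = u \<and> last c = w \<and> (\<forall>y\<in>set c. d y \<le> n)"
    if "u \<in> V" "w \<in> V" "u \<noteq> w" "d u = n" "d w = n" for u w n
    using that
  proof (induction n arbitrary: u w)
    case 0
    then show ?case using d0 by metis
  next
    case (Suc n)
    obtain pu where pu: "{pu, u} \<in> E" "d pu = n" using par Suc.prems by blast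
    obtain pw where pw: "{pw, w} \<in> E" "d pw = n" using par Suc.prems by blast
    show ?case
    proof (cases "pu = pw")
      case True
      have "u \<noteq> pu" "w \<noteq> pu" using pu pw Suc.prems by auto
      moreover have "{u, pu} \<in> E" using pu by (simp add: insert_commute)
      ultimately show ?thesis
        using True pu pw Suc.prems by (intro exI[of _ "[u, pu, w]"]) auto
    next
      case False
      have "pu \<in> V" "pw \<in> V" using pu pw edge_in_vertices[OF T] by auto
      from Suc.IH[OF this False pu(2) pw(2)] obtain c where
        c: "3 \<le> length c" "distinct c" "successively (\<lambda>u v. {u, v} \<in> E) c"
           "hd c = pu" "last c = pw" "\<forall>y\<in>set c. d y \<le> n" by blast
      have "u \<notin> set c" "w \<notin> set c" using c(6) Suc.prems by fastforce+
      moreover have "{u, pu} \<in> E" using pu by (simp add: insert_commute)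
      ultimately show ?thesis using c pw Suc.prems
        by (intro exI[of _ "u # c @ [w]"])
           (auto simp: successively_Cons successively_append_iff hd_append)
    qed
  qed
  have nocyc: "\<not> is_cycle E c" for c using T unfolding tree_def by blast
  have adj: "d u = Suc (d v) \<or> d v = Suc (d u)" if e: "{u, v} \<in> E" for u v
  proof (rule ccontr)
    assume "\<not> ?thesis"
    moreover have "d u \<le> Suc (d v)" "d v \<le> Suc (d u)"
      using step[of u v] step[of v u] e by (auto simp: insert_commute)
    ultimately have "d u = d v" by linarith
    then obtain c where "3 \<le> length c" "distinct c" "successively (\<lambda>u v. {u, v} \<in> E) c"
        "hd c = u" "last c = v"
      using path[of u v "d v"] edge_in_vertices[OF T e] by blast
    then show False using nocyc[of c] successively_is_cycle[of c E] e by (auto simp: insert_commute)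
  qed
  have uniq: "u = w" if e: "{u, v} \<in> E" "{w, v} \<in> E" and "d v = Suc (d u)" "d v = Suc (d w)" for u v w
  proof (rule ccontr)
    assume "u \<noteq> w"
    moreover have "d w = d u" using that by simp
    ultimately obtain c where c: "3 \<le> length c" "distinct c" "successively (\<lambda>u v. {u, v} \<in> E) c"
        "hd c = u" "last c = w" "\<forall>y\<in>set c. d y \<le> d u"
      using path[of u w "d u"] edge_in_vertices[OF T e(1)] edge_in_vertices[OF T e(2)] by metis
    have "v \<notin> set c" "c \<noteq> []" using c(1,6) that by fastforce+
    moreover have "{v, u} \<in> E" "{w, v} \<in> E" using e by (auto simp: insert_commute)
    ultimately show False
      using nocyc[of "v # c"] successively_is_cycle[of "v # c" E] c
      by (auto simp: successively_Cons last_ConsR)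
  qed
  have "d r = 0" using dle[of r 0] by simp
  then show ?thesis using that[of d] adj uniq unfolding tree_depth_def by blast
qed

text \<open>Koenig's theorem for forests: match a deepest non-isolated vertex with its parent and put
  the parent into the cover.\<close>

lemma matching_vertex_cover_equal_card:
  assumes "tree_depth E d" "finite F" "F \<subseteq> E" "\<forall>e\<in>F. card e = 2"
  shows "\<exists>N K. matching F N \<and> finite N \<and> finite K \<and> K \<subseteq> \<Union>F \<and> (\<forall>e\<in>F. e \<inter> K \<noteq> {}) \<and> card N = card K"
  using assms(2-4)
proof (induction "card F" arbitrary: F rule: less_induct)
  case less
  show ?case
  proof (cases "F = {}")
    case True
    then show ?thesis by (intro exI[of _ "{}"]) (simp add: matching_def)
  next
    case False
    have fin: "finite (\<Union>F)" using less.prems by (intro finite_Union) (auto intro: card_ge_0_finite)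
    moreover have "\<Union>F \<noteq> {}" using False less.prems(3) by force
    ultimately have "Max (d ` \<Union>F) \<in> d ` \<Union>F" by (intro Max_in) auto
    then obtain v where v: "v \<in> \<Union>F" "d v = Max (d ` \<Union>F)" by (metis imageE)
    have vmax: "d y \<le> d v" if "y \<in> \<Union>F" for y using v(2) that fin by auto
    from v(1) obtain e where e: "e \<in> F" "v \<in> e" by auto
    have "card e = 2" using e(1) less.prems(3) by blast
    from card_2_other_element[OF this e(2)] obtain p where p: "e = {p, v}" ..
    \<comment> \<open>As \<open>v\<close> is deepest, its only edge in \<open>F\<close> leads to
      \<open>p\<close>. Removing the edges at \<open>p\<close> thus isolates \<open>v\<close>, and
      the new domino \<open>e\<close> is disjoint from all of \<open>N\<close>.\<close>
    have deep: "u = p" if "{u, v} \<in> F" for u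
    proof (rule tree_depth_parent_unique[OF assms(1)])
      show uv: "{u, v} \<in> E" and pv: "{p, v} \<in> E" using that e(1) p less.prems(2) by blast+
      have "d u \<le> d v" "d p \<le> d v" using vmax that e p by blast+
      then show "d v = Suc (d u)" "d v = Suc (d p)"
        using tree_depth_adjacent[OF assms(1) uv] tree_depth_adjacent[OF assms(1) pv] by linarith+
    qed
    let ?F = "{f \<in> F. p \<notin> f}"
    have "p \<in> e" using p by simp
    then have "?F \<subset> F" using e(1) by blast
    then have "card ?F < card F" using less.prems(1) by (rule psubset_card_mono[rotated])
    from less.hyps[OF this] less.prems obtain N K where
      NK: "matching ?F N" "finite N" "finite K" "K \<subseteq> \<Union>?F" "\<forall>f\<in>?F. f \<inter> K \<noteq> {}" "card N = card K"
      by fastforce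
    have vN: "v \<notin> f \<and> p \<notin> f" if f: "f \<in> N" for f
    proof -
      have "f \<in> F" "p \<notin> f" using f NK(1) unfolding matching_def by auto
      moreover have "v \<notin> f"
      proof
        assume "v \<in> f"
        then obtain u where "f = {u, v}"
          using less.prems(3) \<open>f \<in> F\<close> card_2_other_element[of f v] by auto
        then show False using deep \<open>f \<in> F\<close> \<open>p \<notin> f\<close> by blast
      qed
      ultimately show ?thesis by blast
    qed
    have "matching F (insert e N)"
      using NK(1) vN e p unfolding matching_def by auto
    moreover have "e \<notin> N" using vN p by auto
    moreover have "p \<notin> K" using NK(4) by auto
    moreover have "insert p K \<subseteq> \<Union>F" using NK(4) e p by auto
    moreover have "\<forall>f\<in>F. f \<inter> insert p K \<noteq> {}" using NK(5) by auto
    ultimately show ?thesis using NK by (intro exI[of _ "insert e N"] exI[of _ "insert p K"]) auto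
  qed
qed

text \<open>Choosing a cover vertex in each domino gives an injection from \<open>M\<close> to
  \<open>K\<close>; Koenig's theorem bounds \<open>card K\<close> by \<open>card M\<close>, so it is
  a bijection. Hence vertices of \<open>K\<close> are covered, and no domino contains two of them.
  The first fact makes uncovered vertices red, the second carries colours across a domino.\<close>

lemma minimum_vertex_cover_maximum_matching:
  assumes T: "tree V E" and M: "maximum_matching E M" and K: "minimum_vertex_cover V E K"
  shows "K \<subseteq> \<Union>M" and "{i, j} \<in> M \<Longrightarrow> i \<in> K \<Longrightarrow> j \<notin> K"
proof -
  obtain r where "r \<in> V" using T unfolding tree_def connected_graph_def by auto
  then obtain d where d: "tree_depth E d" using tree_depth_exists[OF T] by blast
  have sg: "finite V" "\<forall>e\<in>E. e \<subseteq> V \<and> card e = 2" using T unfolding tree_def simple_graph_def by auto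
  then have finE: "finite E" by (meson Pow_iff finite_Pow_iff finite_subset subsetI)
  from matching_vertex_cover_equal_card[OF d finE] sg(2) obtain N L where
    N: "matching E N" "L \<subseteq> \<Union>E" "\<forall>e\<in>E. e \<inter> L \<noteq> {}" "card N = card L" by blast
  have "vertex_cover V E L" using N sg unfolding vertex_cover_def by auto
  then have "card K \<le> card L" using K unfolding minimum_vertex_cover_def by blast
  also have "\<dots> \<le> card M" using N M unfolding maximum_matching_def by metis
  finally have KM: "card K \<le> card M" .
  have Mm: "M \<subseteq> E" "\<And>e f. e \<in> M \<Longrightarrow> f \<in> M \<Longrightarrow> e \<noteq> f \<Longrightarrow> e \<inter> f = {}"
    using M unfolding maximum_matching_def matching_def by auto
  have Kc: "finite K" "\<And>e. e \<in> E \<Longrightarrow> e \<inter> K \<noteq> {}"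
    using K sg finite_subset unfolding minimum_vertex_cover_def vertex_cover_def by auto
  then have "\<forall>e\<in>M. \<exists>y. y \<in> e \<inter> K" using Mm by blast
  then obtain f where f: "\<And>e. e \<in> M \<Longrightarrow> f e \<in> e \<inter> K" by metis
  have inj: "inj_on f M" using f Mm(2) unfolding inj_on_def by (metis IntD1 disjoint_iff)
  have img: "f ` M = K"
    using f KM Kc(1) card_image[OF inj] by (intro card_seteq) auto
  then show "K \<subseteq> \<Union>M" using f by blast
  show "j \<notin> K" if ij: "{i, j} \<in> M" "i \<in> K"
  proof
    assume "j \<in> K"
    have fe: "f {i, j} = y" if y: "y \<in> K" "y \<in> {i, j}" for y
    proof -
      obtain e where e: "e \<in> M" "y = f e" using y(1) img by auto
      then have "y \<in> e" using f by auto
      then have "e = {i, j}" using Mm(2)[OF e(1) ij(1)] y(2) by auto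
      then show ?thesis using e by simp
    qed
    have "i = j" using fe[of i] fe[of j] \<open>j \<in> K\<close> ij(2) by auto
    then show False using ij Mm(1) edge_in_vertices[OF T] by blast
  qed
qed

lemma neighbor_of_red_is_green:
  assumes "tree V E" "i \<in> red V E" "{i, j} \<in> E"
  shows "j \<in> green V E"
proof -
  have "j \<in> K" if K: "minimum_vertex_cover V E K" for K
  proof -
    have "{i, j} \<inter> K \<noteq> {}"
      using K assms(3) unfolding minimum_vertex_cover_def vertex_cover_def by auto
    moreover have "i \<notin> K" using assms(2) K unfolding red_def by auto
    ultimately show ?thesis by auto
  qed
  then show ?thesis using edge_in_vertices[OF assms(1,3)] unfolding green_def by auto
qed

lemma neighbor_of_red_adj:
  assumes "tree V E" "i \<in> red V E" "{i, j} \<in> E"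
  shows "(i, j) \<in> red_green_adj V E" "(j, i) \<in> red_green_adj V E"
  using neighbor_of_red_is_green[OF assms] assms unfolding red_green_adj_def by (auto simp: insert_commute)

text \<open>From any vertex of \<open>S\<close> an alternating path with its even vertices in \<open>S\<close> reaches a vertex
  that \<open>M\<close> does not cover; a minimum vertex cover contains exactly the odd vertices of that path.\<close>

lemma alternating_path_to_uncovered:
  assumes T: "tree V E" and M: "maximum_matching E M" and SV: "S \<subseteq> V"
    and two: "\<And>i j. i \<in> S \<Longrightarrow> {i, j} \<in> E \<Longrightarrow> \<exists>i'\<in>S. i' \<noteq> i \<and> {i', j} \<in> E"
    and i: "i \<in> S"
  shows "i \<in> red V E" and "\<exists>u\<in>S. u \<notin> \<Union>M \<and> (i, u) \<in> (red_green_adj V E)\<^sup>*"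
proof -
  obtain r where "r \<in> V" using T unfolding tree_def connected_graph_def by auto
  then obtain d where d: "tree_depth E d" using tree_depth_exists[OF T] by blast
  have ME: "M \<subseteq> E" and Mm: "\<And>e f. e \<in> M \<Longrightarrow> f \<in> M \<Longrightarrow> e \<noteq> f \<Longrightarrow> e \<inter> f = {}"
    using M unfolding maximum_matching_def matching_def by auto
  have bound: "\<exists>b. \<forall>i\<in>S. d i \<le> b"
    using SV T finite_subset unfolding tree_def simple_graph_def
    by (metis finite_nat_set_iff_bounded_le finite_imageI imageI)
  then obtain b where b: "\<And>i. i \<in> S \<Longrightarrow> d i \<le> b" by blast
  define Q where "Q i \<longleftrightarrow> i \<in> red V E \<and> (\<exists>u\<in>S. u \<notin> \<Union>M \<and> (i, u) \<in> (red_green_adj V E)\<^sup>*)" for i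
  have uncov: "Q i" if "i \<in> S" "i \<notin> \<Union>M" for i
    unfolding Q_def red_def
    using that SV minimum_vertex_cover_maximum_matching(1)[OF T M] by blast
  \<comment> \<open>\<open>Q\<close> travels backwards over a domino: \<open>i'\<close> red makes
    \<open>j\<close> green, so every minimum cover contains \<open>j\<close> and therefore misses
    its partner \<open>i\<close>.\<close>
  have step: "Q i" if "i \<in> S" "{i, j} \<in> M" "{i', j} \<in> E" "Q i'" for i j i'
  proof -
    have red': "i' \<in> red V E" using that(4) unfolding Q_def by blast
    have g: "j \<in> green V E" by (rule neighbor_of_red_is_green[OF T red' that(3)])
    have ri: "i \<in> red V E"
      using g minimum_vertex_cover_maximum_matching(2)[OF T M _ that(2)] that(1) SV
      unfolding red_def green_def by blast
    have "(i, j) \<in> red_green_adj V E" "(j, i') \<in> red_green_adj V E"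
      using neighbor_of_red_adj[OF T red' that(3)] neighbor_of_red_adj[OF T ri, of j] that(2) ME by auto
    then show ?thesis
      using that(4) ri unfolding Q_def by (meson converse_rtrancl_into_rtrancl)
  qed
  have partner: "i = i'" if "{i, j} \<in> M" "{i', j} \<in> M" for i i' j
    using Mm[OF that] that ME edge_in_vertices[OF T] by (metis disjoint_iff doubleton_eq_iff insertI1 insertI2 subsetD)
  have partner_ex: "\<exists>j. {i, j} \<in> M" if "i \<in> \<Union>M" for i
  proof -
    from that obtain e where e: "e \<in> M" "i \<in> e" by auto
    then have "card e = 2" using ME T unfolding tree_def simple_graph_def by auto
    then obtain y z where "e = {y, z}" by (auto simp: card_2_iff)
    then show ?thesis using e by (auto simp: insert_commute)
  qed
  \<comment> \<open>If the domino of \<open>i\<close> goes to a child \<open>j\<close>, the second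
    neighbour \<open>i'\<close> of \<open>j\<close> is a child of \<open>j\<close>, since
    \<open>i\<close> is the parent. The domino of \<open>i'\<close> cannot go up, because
    \<open>j\<close> is already matched with \<open>i\<close>. So the walk descends two levels at a
    time, and \<open>b\<close> bounds it.\<close>
  have down: "Q i" if "i \<in> S" "\<And>j. {i, j} \<in> M \<Longrightarrow> d j = Suc (d i)" for i
    using that
  proof (induction "b - d i" arbitrary: i rule: less_induct)
    case less
    show ?case
    proof (cases "i \<in> \<Union>M")
      case False
      then show ?thesis using uncov less by blast
    next
      case True
      then obtain j where j: "{i, j} \<in> M" using partner_ex by blast
      then have dj: "d j = Suc (d i)" using less by blast
      obtain i' where i': "i' \<in> S" "i' \<noteq> i" "{i', j} \<in> E" using two[OF less.prems(1)] j ME by blast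
      have di': "d i' = Suc (d j)"
        using tree_depth_parent_unique[OF d i'(3), of i] tree_depth_adjacent[OF d i'(3)] dj i' j ME
        by auto
      have "d j' = Suc (d i')" if j': "{i', j'} \<in> M" for j'
      proof (rule ccontr)
        assume "d j' \<noteq> Suc (d i')"
        then have "d i' = Suc (d j')" using tree_depth_adjacent[OF d, of i' j'] j' ME by auto
        then have "j' = j" using tree_depth_parent_unique[OF d, of j' i' j] di' i' j' ME
          by (auto simp: insert_commute)
        then show False using partner[OF j, of i'] j' i' by auto
      qed
      then have "Q i'" using less.hyps[of i'] b[OF i'(1)] i'(1) di' dj by auto
      then show ?thesis using step less.prems j i' by blast
    qed
  qed
  \<comment> \<open>If the domino of \<open>i\<close> goes up to \<open>j\<close>, then
    \<open>i'\<close> is either the parent of \<open>j\<close>, two levels above \<open>i\<close>,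
    or another child of \<open>j\<close>, to which \<open>down\<close> applies because
    \<open>j\<close> is already matched.\<close>
  have "Q i" using i
  proof (induction "d i" arbitrary: i rule: less_induct)
    case less
    show ?case
    proof (cases "\<exists>j. {i, j} \<in> M \<and> d j \<noteq> Suc (d i)")
      case False
      then show ?thesis using down less by blast
    next
      case True
      then obtain j where j: "{i, j} \<in> M" "d i = Suc (d j)"
        using tree_depth_adjacent[OF d] ME by blast
      obtain i' where i': "i' \<in> S" "i' \<noteq> i" "{i', j} \<in> E" using two[OF less.prems(1)] j ME by blast
      have "Q i'"
      proof (cases "d i' = Suc (d j)")
        case False
        then have "d i' < d i" using tree_depth_adjacent[OF d i'(3)] j by auto
        then show ?thesis using less.hyps i' by blast
      next
        case True
        have "d j' = Suc (d i')" if j': "{i', j'} \<in> M" for j'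
        proof (rule ccontr)
          assume "d j' \<noteq> Suc (d i')"
          then have "d i' = Suc (d j')" using tree_depth_adjacent[OF d, of i' j'] j' ME by auto
          then have "j' = j" using tree_depth_parent_unique[OF d, of j' i' j] True i' j' ME
            by (auto simp: insert_commute)
          then show False using partner[OF j(1), of i'] j' i' by auto
        qed
        then show ?thesis using down i' by blast
      qed
      then show ?thesis using step less.prems j i' by blast
    qed
  qed
  then show "i \<in> red V E" "\<exists>u\<in>S. u \<notin> \<Union>M \<and> (i, u) \<in> (red_green_adj V E)\<^sup>*"
    unfolding Q_def by blast+
qed

text \<open>An admissible set, grown downwards from the root \<open>r\<close>: below each vertex \<open>j\<close> that is adjacent
  to the set, only the single child \<open>c j\<close> is kept.\<close>

inductive_set grown :: "'a set set \<Rightarrow> ('a \<Rightarrow> nat) \<Rightarrow> ('a \<Rightarrow> 'a) \<Rightarrow> 'a \<Rightarrow> 'a set"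
  for E d c r where
  root: "r \<in> grown E d c r"
| child: "i \<in> grown E d c r \<Longrightarrow> {i, j} \<in> E \<Longrightarrow> d j = Suc (d i) \<Longrightarrow> c j \<in> grown E d c r"

text \<open>With the tree rooted at \<open>r\<close>, every member of \<open>grown\<close> other
  than \<open>r\<close> is the chosen child of its own parent, whose parent is again a member. So a
  vertex adjacent to the set has exactly two neighbours in it: its parent and its chosen child. That
  child exists by \<open>two\<close>: a second neighbour in \<open>S\<close> cannot be the parent,
  which is unique.\<close>

lemma admissible_exists:
  assumes T: "tree V E" and Sred: "S \<subseteq> red V E"
    and two: "\<And>i j. i \<in> S \<Longrightarrow> {i, j} \<in> E \<Longrightarrow> \<exists>i'\<in>S. i' \<noteq> i \<and> {i', j} \<in> E"
    and r: "r \<in> S"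
  obtains S' \<epsilon> where "S' \<subseteq> S" "admissible V E {w. (r, w) \<in> (red_green_adj V E)\<^sup>*} S'"
    "admissible_signs V E S' \<epsilon>"
proof -
  let ?C = "{w. (r, w) \<in> (red_green_adj V E)\<^sup>*}"
  have "r \<in> V" using r Sred unfolding red_def by auto
  then obtain d where d: "tree_depth E d" and dr: "d r = 0" using tree_depth_exists[OF T] by blast
  define c where "c j = (SOME i'. i' \<in> S \<and> {i', j} \<in> E \<and> d i' = Suc (d j))" for j
  let ?S = "grown E d c r"
  have c: "c j \<in> S \<and> {c j, j} \<in> E \<and> d (c j) = Suc (d j)"
    if ij: "i \<in> S" "{i, j} \<in> E" "d j = Suc (d i)" for i j
  proof -
    obtain i' where i': "i' \<in> S" "i' \<noteq> i" "{i', j} \<in> E" using two[OF ij(1,2)] by blast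
    then have "d i' = Suc (d j)"
      using tree_depth_parent_unique[OF d i'(3) ij(2) _ ij(3)] tree_depth_adjacent[OF d i'(3)] i'(2)
      by blast
    with i' have "i' \<in> S \<and> {i', j} \<in> E \<and> d i' = Suc (d j)" by blast
    then show ?thesis unfolding c_def by (rule someI)
  qed
  have S: "i \<in> S \<and> (r, i) \<in> (red_green_adj V E)\<^sup>* \<and> even (d i) \<and>
      (i = r \<or> (\<exists>p\<in>?S. \<exists>j. {p, j} \<in> E \<and> d j = Suc (d p) \<and> i = c j))" if "i \<in> ?S" for i
    using that
  proof induction
    case root
    then show ?case using r dr by simp
  next
    case (child i j)
    have iS: "i \<in> S" using child by blast
    note cj = c[OF iS child(2,3)]
    have "(i, j) \<in> red_green_adj V E" "(j, c j) \<in> red_green_adj V E"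
      using neighbor_of_red_adj[OF T, of i j] neighbor_of_red_adj[OF T, of "c j" j] iS cj Sred child by auto
    then have "(r, c j) \<in> (red_green_adj V E)\<^sup>*" using child by (meson rtrancl.rtrancl_into_rtrancl)
    then show ?case using cj child by auto
  qed
  have nbrs: "\<exists>p. p \<in> ?S \<and> {p, g} \<in> E \<and> d g = Suc (d p) \<and> neighbors E g \<inter> ?S = {p, c g}"
    if i: "i \<in> ?S" "{i, g} \<in> E" for i g
  proof -
    have "\<exists>p. p \<in> ?S \<and> {p, g} \<in> E \<and> d g = Suc (d p)"
    proof (cases "d g = Suc (d i)")
      case True
      then show ?thesis using i by blast
    next
      case False
      then have di: "d i = Suc (d g)" using tree_depth_adjacent[OF d i(2)] by auto
      then have "i \<noteq> r" using dr by auto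
      then obtain p j where p: "p \<in> ?S" "{p, j} \<in> E" "d j = Suc (d p)" "i = c j" using S[OF i(1)] by blast
      have "{j, i} \<in> E" "d i = Suc (d j)"
        using c[of p j] S[OF p(1)] p(2-4) edge_commute[of j i E] by blast+
      then have "j = g" using tree_depth_parent_unique[OF d, of j i g] i(2) di edge_commute[of g i E] by blast
      then show ?thesis using p by blast
    qed
    then obtain p where p: "p \<in> ?S" "{p, g} \<in> E" "d g = Suc (d p)" by blast
    have cg: "c g \<in> ?S" "{c g, g} \<in> E" using grown.child[OF p] c[of p g] S[OF p(1)] p by auto
    have "y = p \<or> y = c g" if y: "y \<in> ?S" "{y, g} \<in> E" for y
    proof (cases "d g = Suc (d y)")
      case True
      then show ?thesis using tree_depth_parent_unique[OF d y(2) p(2) _ p(3)] by blast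
    next
      case False
      then have dy: "d y = Suc (d g)" using tree_depth_adjacent[OF d y(2)] by auto
      then have "y \<noteq> r" using dr by auto
      then obtain q j where q: "q \<in> ?S" "{q, j} \<in> E" "d j = Suc (d q)" "y = c j" using S[OF y(1)] by blast
      have "{j, y} \<in> E" "d y = Suc (d j)"
        using c[of q j] S[OF q(1)] q(2-4) edge_commute[of j y E] by blast+
      then have "j = g" using tree_depth_parent_unique[OF d, of j y g] y(2) dy edge_commute[of g y E] by blast
      then show ?thesis using q by blast
    qed
    then have "neighbors E g \<inter> ?S = {p, c g}" using p cg unfolding neighbors_def by auto
    then show ?thesis using p by blast
  qed
  \<comment> \<open>Members have even depth, and two members with a common neighbour differ in depth
    by exactly 2; the depth modulo 4 therefore alternates.\<close>
  define \<epsilon> where "\<epsilon> i = (if d i mod 4 = 0 then 1 else - 1 :: int)" for i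
  have cdep: "d (c g) = Suc (d g)" if "p \<in> ?S" "{p, g} \<in> E" "d g = Suc (d p)" for p g
    using c[of p g] S[of p] that by blast
  show thesis
  proof
    show "?S \<subseteq> S" using S by blast
    show "admissible V E ?C ?S"
      unfolding admissible_def
    proof (intro conjI ballI)
      show "?S \<noteq> {}" using grown.root by fast
      show "?S \<subseteq> ?C \<inter> red V E" using S Sred by blast
      fix g assume "g \<in> ?C \<inter> green V E"
      show "card (neighbors E g \<inter> ?S) \<in> {0, 2}"
      proof (cases "neighbors E g \<inter> ?S = {}")
        case False
        then obtain i where "i \<in> ?S" "{i, g} \<in> E" unfolding neighbors_def by auto
        from nbrs[OF this] obtain p where p: "p \<in> ?S" "{p, g} \<in> E" "d g = Suc (d p)"
          "neighbors E g \<inter> ?S = {p, c g}" by blast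
        then have "p \<noteq> c g" using cdep[of p g] by auto
        then show ?thesis using p by simp
      qed simp
    qed
    show "admissible_signs V E ?S \<epsilon>"
      unfolding admissible_signs_def
    proof (intro conjI ballI impI)
      fix i assume "i \<in> ?S"
      show "\<epsilon> i \<in> {1, - 1}" unfolding \<epsilon>_def by simp
    next
      fix i j assume i: "i \<in> ?S" and j: "j \<in> ?S" 
        and ij: "i \<noteq> j \<and> neighbors E i \<inter> neighbors E j \<inter> green V E \<noteq> {}"
      then obtain g where g: "{g, i} \<in> E" "{g, j} \<in> E" unfolding neighbors_def by auto
      obtain p where p: "p \<in> ?S" "{p, g} \<in> E" "d g = Suc (d p)" "neighbors E g \<inter> ?S = {p, c g}"
        using nbrs[of i g] i g by (auto simp: insert_commute)
      have "i \<in> neighbors E g \<inter> ?S" "j \<in> neighbors E g \<inter> ?S"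
        using i j g unfolding neighbors_def by (auto simp: insert_commute)
      then have "{i, j} = {p, c g}" using ij p(4) by auto
      moreover have "d (c g) = d p + 2" using cdep[OF p(1-3)] p(3) by simp
      moreover have "even (d p)" using S[OF p(1)] by blast
      ultimately show "\<epsilon> j = - \<epsilon> i" unfolding \<epsilon>_def by (auto simp: doubleton_eq_iff) presburger+
    qed
  qed
qed

section \<open>Ideals and prime ideals\<close>

text \<open>The ring as a module over itself: \<open>regular.subspace\<close> means ideal, and
  \<open>regular.span\<close> is the ideal generated by a set.\<close>

interpretation regular: module "(*) :: 'r::comm_ring_1 \<Rightarrow> 'r \<Rightarrow> 'r"
  by unfold_locales (simp_all add: algebra_simps)

declare regular.scale_scale [simp del]  \<comment> \<open>would loop with \<open>mult.assoc\<close>\<close>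

definition prime_ideal :: "'r::comm_ring_1 set \<Rightarrow> bool" where
  "prime_ideal m \<longleftrightarrow> regular.subspace m \<and> 1 \<notin> m \<and> (\<forall>a b. a * b \<in> m \<longrightarrow> a \<in> m \<or> b \<in> m)"

text \<open>Zorn's lemma gives an ideal maximal among the proper ones containing \<open>K\<close>.
  By maximality each element outside it is invertible modulo it, and this makes it prime.\<close>

lemma prime_ideal_exists:
  assumes K: "regular.subspace (K :: 'r::comm_ring_1 set)" "1 \<notin> K"
  obtains m where "prime_ideal m" "K \<subseteq> m"
proof -
  define A where "A = {m :: 'r set. regular.subspace m \<and> 1 \<notin> m \<and> K \<subseteq> m}"
  have "\<exists>m\<in>A. \<forall>X\<in>A. m \<subseteq> X \<longrightarrow> X = m"
  proof (rule subset_Zorn_nonempty)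
    show "A \<noteq> {}" using K unfolding A_def by auto
  next
    fix C assume C: "C \<noteq> {}" "subset.chain A C"
    then have sub: "\<And>X. X \<in> C \<Longrightarrow> regular.subspace X \<and> 1 \<notin> X \<and> K \<subseteq> X"
      unfolding subset.chain_def A_def by auto
    have "regular.subspace (\<Union>C)"
    proof (rule regular.subspaceI)
      show "0 \<in> \<Union>C" using C(1) sub regular.subspace_0 by fastforce
    next
      fix a b assume "a \<in> \<Union>C" "b \<in> \<Union>C"
      then obtain X Y where "a \<in> X" "b \<in> Y" "X \<in> C" "Y \<in> C" by blast
      moreover from this have "X \<subseteq> Y \<or> Y \<subseteq> X" using C(2) unfolding subset.chain_def by blast
      ultimately show "a + b \<in> \<Union>C" using sub regular.subspace_add by blast
    next
      fix a c assume "a \<in> \<Union>C"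
      then show "c * a \<in> \<Union>C" using sub regular.subspace_scale by blast
    qed
    then show "\<Union>C \<in> A" using sub C(1) unfolding A_def by auto
  qed
  then obtain m where m: "m \<in> A" and max: "\<And>X. X \<in> A \<Longrightarrow> m \<subseteq> X \<Longrightarrow> X = m" by blast
  have sm: "regular.subspace m" "1 \<notin> m" "K \<subseteq> m" using m unfolding A_def by auto
  have ext: "\<exists>r. 1 - r * a \<in> m" if "a \<notin> m" for a
  proof -
    define X where "X = {y + r * a | y r. y \<in> m}"
    have "y + 0 * a \<in> X" if "y \<in> m" for y
      unfolding X_def using that by blast
    then have sub: "m \<subseteq> X" by auto
    have "0 + 1 * a \<in> X" unfolding X_def using regular.subspace_0[OF sm(1)] by blast
    then have "a \<in> X" by simp
    have "regular.subspace X"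
    proof (rule regular.subspaceI)
      show "0 \<in> X" using sub regular.subspace_0[OF sm(1)] by blast
    next
      fix u v assume "u \<in> X" "v \<in> X"
      then obtain y r z s where "u = y + r * a" "y \<in> m" "v = z + s * a" "z \<in> m" unfolding X_def by blast
      then have "u + v = (y + z) + (r + s) * a" "y + z \<in> m"
        using regular.subspace_add[OF sm(1)] by (auto simp: algebra_simps)
      then show "u + v \<in> X" unfolding X_def by blast
    next
      fix c u assume "u \<in> X"
      then obtain y r where "u = y + r * a" "y \<in> m" unfolding X_def by blast
      moreover from this have "c * y \<in> m" using regular.subspace_scale[OF sm(1)] by blast
      ultimately have "c * u = c * y + (c * r) * a" "c * y \<in> m" by (simp_all add: algebra_simps)
      then show "c * u \<in> X" unfolding X_def by blast
    qed
    moreover have "X \<noteq> m" using \<open>a \<in> X\<close> that by blast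
    ultimately have "1 \<in> X" using max[of X] sub sm(3) unfolding A_def by blast
    then obtain y r where "1 = y + r * a" "y \<in> m" unfolding X_def by blast
    then have "1 - r * a \<in> m" by (metis add_diff_cancel_right')
    then show ?thesis ..
  qed
  have "a \<in> m \<or> b \<in> m" if ab: "a * b \<in> m" for a b
  proof (rule ccontr)
    assume "\<not> ?thesis"
    then obtain r where r: "1 - r * a \<in> m" and b: "b \<notin> m" using ext by blast
    have "b = b * (1 - r * a) + r * (a * b)" by (simp add: algebra_simps)
    then have "b \<in> m"
      using regular.subspace_add[OF sm(1) regular.subspace_scale[OF sm(1) r, of b]
        regular.subspace_scale[OF sm(1) ab, of r]] by simp
    then show False using b by blast
  qed
  then show ?thesis using that[of m] sm unfolding prime_ideal_def by blast
qed

lemma prime_ideal_mult: "prime_ideal m \<Longrightarrow> a \<notin> m \<Longrightarrow> b \<notin> m \<Longrightarrow> a * b \<notin> m"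
  unfolding prime_ideal_def by blast

lemma prime_ideal_subspace: "prime_ideal m \<Longrightarrow> regular.subspace m"
  unfolding prime_ideal_def by blast

lemma prime_ideal_prod:
  "finite A \<Longrightarrow> prime_ideal m \<Longrightarrow> (\<And>i. i \<in> A \<Longrightarrow> f i \<notin> m) \<Longrightarrow> prod f A \<notin> m"
  by (induction A rule: finite_induct) (auto simp: prime_ideal_def)

lemma ideal_dvd: "regular.subspace I \<Longrightarrow> a \<in> I \<Longrightarrow> a dvd b \<Longrightarrow> b \<in> I"
  by (metis dvdE mult.commute regular.subspace_scale)

lemma ideal_prod_cong:
  fixes f g :: "'i \<Rightarrow> 'r::comm_ring_1"
  assumes I: "regular.subspace I" and "\<And>i. i \<in> A \<Longrightarrow> f i - g i \<in> I"
  shows "prod f A - prod g A \<in> I"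
  using assms(2)
proof (induction A rule: infinite_finite_induct)
  case (insert k A)
  have "prod f (insert k A) - prod g (insert k A)
      = f k * (prod f A - prod g A) + prod g A * (f k - g k)"
    using insert by (simp add: algebra_simps)
  then show ?case
    using insert by (metis I insert_iff regular.subspace_add regular.subspace_scale)
qed (use I regular.subspace_0 in auto)

section \<open>The square of an ideal and first-order expansion\<close>

definition ideal_square :: "'r::comm_ring_1 set \<Rightarrow> 'r set" where
  "ideal_square I = regular.span {p * q | p q. p \<in> I \<and> q \<in> I}"

lemma ideal_square_mult: "p \<in> I \<Longrightarrow> q \<in> I \<Longrightarrow> p * q \<in> ideal_square I"
  unfolding ideal_square_def by (rule regular.span_base) blast

lemma ideal_square_subspace: "regular.subspace (ideal_square I)"
  unfolding ideal_square_def by (rule regular.subspace_span)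

text \<open>First-order Taylor expansion of a monomial: all terms with at least two factors
  \<open>d i\<close> fall into the square of \<open>I\<close>. Splitting off the factor
  \<open>k\<close> leaves the second-order term \<open>d k\<close> times the old linear part, plus a
  multiple of the old remainder.\<close>

lemma prod_perturb:
  fixes x d :: "'i \<Rightarrow> 'r::comm_ring_1"
  assumes I: "regular.subspace I" and "finite A" and "\<And>i. i \<in> A \<Longrightarrow> d i \<in> I"
  shows "(\<Prod>i\<in>A. x i + d i) - (prod x A + (\<Sum>j\<in>A. prod x (A - {j}) * d j)) \<in> ideal_square I"
  using assms(2,3)
proof (induction A rule: finite_induct)
  case empty
  then show ?case by (simp add: regular.subspace_0[OF ideal_square_subspace])
next
  case (insert k A)
  have expand: "(a + b) * D - (a * P + (P * b + a * L)) = b * L + (a + b) * (D - (P + L))"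
    for a b D P L :: 'r by (simp add: algebra_simps)
  let ?L = "\<Sum>j\<in>A. prod x (A - {j}) * d j"
  let ?q = "(\<Prod>i\<in>A. x i + d i) - (prod x A + ?L)"
  have q: "?q \<in> ideal_square I" using insert by auto
  have "?L \<in> I"
    using insert.prems I by (intro regular.subspace_sum regular.subspace_scale) auto
  then have dL: "d k * ?L \<in> ideal_square I" using insert.prems by (intro ideal_square_mult) auto
  have "prod x (insert k A - {j}) * d j = x k * (prod x (A - {j}) * d j)" if "j \<in> A" for j
  proof -
    have "k \<noteq> j" using that insert.hyps by auto
    then show ?thesis using insert.hyps by (simp add: insert_Diff_if mult.assoc)
  qed
  then have "(\<Sum>j\<in>A. prod x (insert k A - {j}) * d j) = (\<Sum>j\<in>A. x k * (prod x (A - {j}) * d j))"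
    by (rule sum.cong[OF refl])
  then have "(\<Sum>j\<in>A. prod x (insert k A - {j}) * d j) = x k * ?L"
    by (simp only: sum_distrib_left)
  moreover have "insert k A - {k} = A" using insert.hyps by auto
  ultimately have "(\<Prod>i\<in>insert k A. x i + d i) - (prod x (insert k A) + (\<Sum>j\<in>insert k A. prod x (insert k A - {j}) * d j))
      = (x k + d k) * (\<Prod>i\<in>A. x i + d i) - (x k * prod x A + (prod x A * d k + x k * ?L))"
    using insert.hyps by simp
  also have "\<dots> = d k * ?L + (x k + d k) * ?q"
    by (rule expand)
  finally have "(\<Prod>i\<in>insert k A. x i + d i) - (prod x (insert k A) + (\<Sum>j\<in>insert k A. prod x (insert k A - {j}) * d j))
      = d k * ?L + (x k + d k) * ?q" .
  then show ?case
    by (simp only:) (intro regular.subspace_add regular.subspace_scale ideal_square_subspace dL q)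
qed

text \<open>Along an admissible set every neighbouring variable occurs once with each sign, so the
  relations \<open>\<alpha>\<^sub>i \<Prod>\<^sub>j x\<^sub>j = -1\<close> multiply to a monomial identity in the \<open>\<alpha>\<^sub>i\<close> alone.\<close>

lemma admissible_product:
  fixes p :: "'a \<Rightarrow> 'k::field" and x :: "'a \<Rightarrow> 'r::comm_ring_1" and \<iota> :: "'k \<Rightarrow> 'r"
  assumes T: "tree V E" and C: "C \<in> red_green_components V E"
    and S: "admissible V E C S" and \<epsilon>: "admissible_signs V E S \<epsilon>"
    and m: "prime_ideal m"
    and \<iota>: "\<iota> 1 = 1" "\<And>c d. \<iota> (c * d) = \<iota> c * \<iota> d" "\<And>c d. \<iota> (c + d) = \<iota> c + \<iota> d"
    and rel: "\<And>i. i \<in> S \<Longrightarrow> \<iota> (p i) * (\<Prod>j\<in>neighbors E i. x j) + 1 \<in> m"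
  shows "(\<Prod>i\<in>S. p i powi \<epsilon> i) = (- 1) ^ card S"
proof -
  note sm = prime_ideal_subspace[OF m]
  have \<iota>0: "\<iota> 0 = 0" using \<iota>(3)[of 0 0] by simp
  have \<iota>m: "\<iota> (- c) = - \<iota> c" for c using \<iota>(3)[of c "- c"] \<iota>0 by (simp add: eq_neg_iff_add_eq_0 add.commute)
  have \<iota>d: "\<iota> (c - d) = \<iota> c - \<iota> d" for c d using \<iota>(3)[of c "- d"] \<iota>m by simp
  have \<iota>p: "\<iota> (prod f A) = (\<Prod>i\<in>A. \<iota> (f i))" for f :: "'a \<Rightarrow> 'k" and A
    by (induction A rule: infinite_finite_induct) (simp_all add: \<iota>)
  have \<iota>s: "\<iota> ((- 1) ^ n) = (- 1) ^ n" for n by (induction n) (simp_all add: \<iota> \<iota>m)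
  have inj: "c = 0" if "\<iota> c \<in> m" for c
  proof (rule ccontr)
    assume "c \<noteq> 0"
    then have "\<iota> (inverse c) * \<iota> c = 1" using \<iota>(1,2) by (metis left_inverse)
    then have "1 \<in> m" using regular.subspace_scale[OF sm that, of "\<iota> (inverse c)"] by simp
    then show False using m unfolding prime_ideal_def by blast
  qed
  have one: "(1 :: 'r) \<notin> m" using m unfolding prime_ideal_def by blast
  have finV: "finite V" using T unfolding tree_def simple_graph_def by simp
  have Sred: "S \<subseteq> red V E" and SC: "S \<subseteq> C" using S unfolding admissible_def by simp_all
  then have SV: "S \<subseteq> V" unfolding red_def by blast
  with finV have finS: "finite S" by (rule finite_subset[rotated])
  have finN: "finite (neighbors E i)" for i
    using edge_in_vertices(1)[OF T] finV finite_subset[of "neighbors E i" V] unfolding neighbors_def by blast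
  \<comment> \<open>For \<open>p i = 0\<close> the hypothesis \<open>rel\<close> would read
    \<open>1 \<in> m\<close>.\<close>
  have p0: "p i \<noteq> 0" if "i \<in> S" for i using rel[OF that] one \<iota>0 by auto
  have sign: "\<epsilon> i = 1 \<or> \<epsilon> i = - 1" if "i \<in> S" for i
    using \<epsilon> that unfolding admissible_signs_def by auto
  have opp: "\<epsilon> i' = - \<epsilon> i" if "i \<in> S" "i' \<in> S" "i \<noteq> i'" "j \<in> neighbors E i" "j \<in> neighbors E i'" for i i' j
  proof -
    have "{i, j} \<in> E" using that(4) edge_commute[of i j E] unfolding neighbors_def by simp
    then have "j \<in> green V E" using neighbor_of_red_is_green[OF T] Sred that(1) by blast
    then show ?thesis using \<epsilon> that unfolding admissible_signs_def by blast
  qed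
  have other: "\<exists>i'\<in>S. i' \<noteq> i \<and> j \<in> neighbors E i'" if i: "i \<in> S" "j \<in> neighbors E i" for i j
  proof -
    have e: "{i, j} \<in> E" using i(2) edge_commute[of i j E] unfolding neighbors_def by simp
    then have "j \<in> green V E" using neighbor_of_red_is_green[OF T] Sred i(1) by blast
    moreover have "j \<in> C"
      using C SC i(1) neighbor_of_red_adj(1)[OF T _ e] Sred
      unfolding red_green_components_def by (auto intro: rtrancl_into_rtrancl)
    ultimately have "card (neighbors E j \<inter> S) \<in> {0, 2}" using S unfolding admissible_def by blast
    moreover have iN: "i \<in> neighbors E j \<inter> S" using e i(1) unfolding neighbors_def by simp
    moreover have "finite (neighbors E j \<inter> S)" using finS by simp
    ultimately have "card (neighbors E j \<inter> S) = 2" by (auto simp: card_eq_0_iff)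
    then have "neighbors E j \<inter> S \<noteq> {i}" by auto
    then obtain i' where "i' \<in> neighbors E j \<inter> S" "i' \<noteq> i" using iN by blast
    then show ?thesis using edge_commute[of j i' E] unfolding neighbors_def by auto
  qed
  let ?A = "\<lambda>s. {i \<in> S. \<epsilon> i = s}"
  let ?X = "\<lambda>s. \<Prod>i\<in>?A s. \<Prod>j\<in>neighbors E i. x j"
  \<comment> \<open>Members of equal sign share no neighbour, by \<open>opp\<close>, so the double
    product visits each neighbour once.\<close>
  have union: "?X s = (\<Prod>j\<in>(\<Union>i\<in>?A s. neighbors E i). x j)" if "s \<noteq> 0" for s
  proof (rule prod.UNION_disjoint[symmetric])
    show "\<forall>i\<in>?A s. \<forall>i'\<in>?A s. i \<noteq> i' \<longrightarrow> neighbors E i \<inter> neighbors E i' = {}"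
    proof (intro ballI impI)
      fix i i' assume i: "i \<in> ?A s" and i': "i' \<in> ?A s" and "i \<noteq> i'"
      have False if "j \<in> neighbors E i" "j \<in> neighbors E i'" for j
        using opp[of i i' j] i i' \<open>i \<noteq> i'\<close> \<open>s \<noteq> 0\<close> that by simp
      then show "neighbors E i \<inter> neighbors E i' = {}" by blast
    qed
  qed (simp_all add: finS finN)
  \<comment> \<open>Each neighbour of a member has a second member next to it, necessarily of the
    opposite sign. Thus both sign classes yield the same product \<open>X\<close>.\<close>
  have same: "(\<Union>i\<in>?A 1. neighbors E i) = (\<Union>i\<in>?A (- 1). neighbors E i)"
  proof -
    have "j \<in> (\<Union>i\<in>?A (- s). neighbors E i)" if "i \<in> ?A s" "j \<in> neighbors E i" for i j s
      using other[of i j] opp[of i _ j] that by fastforce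
    from this[of _ 1] this[of _ "- 1"] show ?thesis by fastforce
  qed
  define X where "X = ?X 1"
  have X: "?X 1 = X" "?X (- 1) = X" using union[of 1] union[of "- 1"] same unfolding X_def by auto
  let ?P = "\<lambda>s. \<Prod>i\<in>?A s. p i"
  have key: "\<iota> (?P s) * ?X s - (- 1) ^ card (?A s) \<in> m" for s
  proof -
    have "(\<Prod>i\<in>?A s. \<iota> (p i) * (\<Prod>j\<in>neighbors E i. x j)) - (\<Prod>i\<in>?A s. - 1) \<in> m"
      by (rule ideal_prod_cong[OF sm]) (use rel in auto)
    then show ?thesis by (simp add: prod.distrib \<iota>p)
  qed
  have k1: "\<iota> (?P 1) * X - (- 1) ^ card (?A 1) \<in> m" and k2: "\<iota> (?P (- 1)) * X - (- 1) ^ card (?A (- 1)) \<in> m"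
    using key[of 1] key[of "- 1"] X by simp_all
  let ?n = "card (?A 1)" and ?l = "card (?A (- 1))"
  have sq: "(- 1 :: 'r) ^ n * (- 1) ^ n = 1" for n by (simp flip: power_add)
  have "X \<notin> m"
  proof
    assume "X \<in> m"
    then have "(- 1 :: 'r) ^ ?n \<in> m"
      using regular.subspace_diff[OF sm regular.subspace_scale[OF sm, of X "\<iota> (?P 1)"] k1] by simp
    then have "(1 :: 'r) \<in> m" using regular.subspace_scale[OF sm, of "(- 1) ^ ?n" "(- 1) ^ ?n"] sq by simp
    then show False using one by blast
  qed
  \<comment> \<open>Eliminating \<open>X\<close> between the two congruences puts a constant times
    \<open>X\<close> into \<open>m\<close>. As \<open>X\<close> is outside \<open>m\<close> and the
    field embeds modulo \<open>m\<close>, the constant is zero.\<close>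
  have "\<iota> (?P 1 * (- 1) ^ ?l - ?P (- 1) * (- 1) ^ ?n) * X
      = (- 1) ^ ?l * (\<iota> (?P 1) * X - (- 1) ^ ?n) - (- 1) ^ ?n * (\<iota> (?P (- 1)) * X - (- 1) ^ ?l)"
    by (simp only: \<iota>d \<iota>(2) \<iota>s) (simp add: algebra_simps)
  also have "\<dots> \<in> m"
    by (rule regular.subspace_diff[OF sm regular.subspace_scale[OF sm k1] regular.subspace_scale[OF sm k2]])
  finally have "\<iota> (?P 1 * (- 1) ^ ?l - ?P (- 1) * (- 1) ^ ?n) \<in> m"
    using prime_ideal_mult[OF m _ \<open>X \<notin> m\<close>] by blast
  from inj[OF this] have eq: "?P 1 * (- 1) ^ ?l = ?P (- 1) * (- 1) ^ ?n"
    by (rule eq_iff_diff_eq_0[THEN iffD2])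
  have SA: "S = ?A 1 \<union> ?A (- 1)" "?A 1 \<inter> ?A (- 1) = {}" "finite (?A 1)" "finite (?A (- 1))"
    using sign finS by auto
  have P0: "?P (- 1) \<noteq> 0" using p0 finS by simp
  have "(\<Prod>i\<in>S. p i powi \<epsilon> i) = (\<Prod>i\<in>?A 1. p i powi \<epsilon> i) * (\<Prod>i\<in>?A (- 1). p i powi \<epsilon> i)"
    using arg_cong[OF SA(1), of "prod (\<lambda>i. p i powi \<epsilon> i)"] unfolding prod.union_disjoint[OF SA(3,4,2)] .
  also have "(\<Prod>i\<in>?A 1. p i powi \<epsilon> i) = ?P 1"
    by (rule prod.cong) simp_all
  also have "(\<Prod>i\<in>?A (- 1). p i powi \<epsilon> i) = (\<Prod>i\<in>?A (- 1). inverse (p i))"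
    by (rule prod.cong) (simp_all add: power_int_minus)
  also have "\<dots> = inverse (?P (- 1))"
    by (rule prod_inversef[unfolded o_def])
  also have "?P 1 * inverse (?P (- 1)) = (- 1) ^ ?n * (- 1) ^ ?l"
  proof -
    have "?P 1 = ?P 1 * (- 1) ^ ?l * (- 1) ^ ?l" by (simp add: mult.assoc flip: power_add)
    also have "\<dots> = (- 1) ^ ?n * (- 1) ^ ?l * ?P (- 1)" by (simp only: eq ac_simps)
    finally show ?thesis using P0 by (simp only: mult.assoc right_inverse mult_1_right not_False_eq_True)
  qed
  also have "\<dots> = (- 1) ^ card S"
    using arg_cong[OF SA(1), of card] unfolding card_Un_disjoint[OF SA(3,4,2)] by (simp only: power_add)
  finally show ?thesis .
qed

section \<open>The Jacobian of the vertex relations\<close>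

text \<open>\<open>U\<close> marks the vertices at which \<open>a i\<close> is a free coordinate.
  The relations are only required modulo \<open>I\<close>, so the argument runs in the polynomial
  ring and needs no quotient.\<close>

locale vertex_system =
  fixes V U :: "'a set" and nb :: "'a \<Rightarrow> 'a set" and x x' a :: "'a \<Rightarrow> 'r::comm_ring_1" and I :: "'r set"
  assumes finV: "finite V" and nbV: "\<And>i. nb i \<subseteq> V" and sym: "\<And>i j. j \<in> nb i \<Longrightarrow> i \<in> nb j"
    and ideal: "regular.subspace I"
    and rel: "\<And>i. i \<in> V \<Longrightarrow> x i * x' i - (1 + a i * prod x (nb i)) \<in> I"
begin

lemma finite_nb: "finite (nb i)"
  using finV nbV finite_subset by blast

text \<open>The differential of the vertex relation at \<open>i\<close>, in the directions
  \<open>d\<close>, \<open>d'\<close>, \<open>da\<close> of \<open>x\<close>, \<open>x'\<close>,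
  \<open>a\<close>. Outside \<open>U\<close> the coefficient is a constant, hence has no
  direction.\<close>

definition jac :: "('a \<Rightarrow> 'r) \<Rightarrow> ('a \<Rightarrow> 'r) \<Rightarrow> ('a \<Rightarrow> 'r) \<Rightarrow> 'a \<Rightarrow> 'r" where
  "jac d d' da i = x i * d' i + x' i * d i
     - (a i * (\<Sum>j\<in>nb i. prod x (nb i - {j}) * d j) + (if i \<in> U then prod x (nb i) * da i else 0))"

definition in_image :: "('a \<Rightarrow> 'r) \<Rightarrow> bool" where
  "in_image f \<longleftrightarrow> (\<exists>d d' da. \<forall>i\<in>V. f i - jac d d' da i \<in> I)"

abbreviation unit_vec :: "'a \<Rightarrow> 'a \<Rightarrow> 'r" where
  "unit_vec i \<equiv> (\<lambda>j. if j = i then 1 else 0)"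

lemma jac_add: "jac (\<lambda>i. d i + e i) (\<lambda>i. d' i + e' i) (\<lambda>i. da i + ea i) i = jac d d' da i + jac e e' ea i"
  unfolding jac_def by (simp add: algebra_simps sum.distrib)

lemma jac_scale: "jac (\<lambda>i. c * d i) (\<lambda>i. c * d' i) (\<lambda>i. c * da i) i = c * jac d d' da i"
  unfolding jac_def by (simp add: algebra_simps sum_distrib_left)

lemma jac_0: "jac (\<lambda>i. 0) (\<lambda>i. 0) (\<lambda>i. 0) i = 0"
  unfolding jac_def by simp

lemma jac_sum:
  "finite A \<Longrightarrow> jac (\<lambda>i. \<Sum>k\<in>A. c k * d k i) (\<lambda>i. \<Sum>k\<in>A. c k * d' k i) (\<lambda>i. \<Sum>k\<in>A. c k * da k i) i
    = (\<Sum>k\<in>A. c k * jac (d k) (d' k) (da k) i)"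
  by (induction A rule: finite_induct) (simp_all add: jac_0 jac_add jac_scale)

lemma in_image_add: "in_image f \<Longrightarrow> in_image g \<Longrightarrow> in_image (\<lambda>i. f i + g i)"
proof -
  assume "in_image f" "in_image g"
  then obtain d d' da e e' ea where
    h: "\<And>i. i \<in> V \<Longrightarrow> f i - jac d d' da i \<in> I" "\<And>i. i \<in> V \<Longrightarrow> g i - jac e e' ea i \<in> I"
    unfolding in_image_def by blast
  have "f i + g i - jac (\<lambda>i. d i + e i) (\<lambda>i. d' i + e' i) (\<lambda>i. da i + ea i) i \<in> I" if "i \<in> V" for i
    using regular.subspace_add[OF ideal h(1)[OF that] h(2)[OF that]] unfolding jac_add
    by (simp add: algebra_simps)
  then show ?thesis unfolding in_image_def by blast
qed

lemma in_image_scale: "in_image f \<Longrightarrow> in_image (\<lambda>i. c * f i)"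
proof -
  assume "in_image f"
  then obtain d d' da where h: "\<And>i. i \<in> V \<Longrightarrow> f i - jac d d' da i \<in> I" unfolding in_image_def by blast
  have "c * f i - jac (\<lambda>i. c * d i) (\<lambda>i. c * d' i) (\<lambda>i. c * da i) i \<in> I" if "i \<in> V" for i
    using regular.subspace_scale[OF ideal h[OF that], of c] unfolding jac_scale
    by (simp add: algebra_simps)
  then show ?thesis unfolding in_image_def by blast
qed

lemma in_image_cong:
  assumes "in_image g" "\<And>i. i \<in> V \<Longrightarrow> f i - g i \<in> I"
  shows "in_image f"
proof -
  from assms(1) obtain d d' da where h: "\<And>i. i \<in> V \<Longrightarrow> g i - jac d d' da i \<in> I" unfolding in_image_def by blast
  have "f i - jac d d' da i \<in> I" if "i \<in> V" for i
    using regular.subspace_add[OF ideal assms(2)[OF that] h[OF that]] by simp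
  then show ?thesis unfolding in_image_def by blast
qed

lemma in_image_jac: "in_image (jac d d' da)"
  unfolding in_image_def using regular.subspace_0[OF ideal]
  by (intro exI[of _ d] exI[of _ d'] exI[of _ da]) simp

lemma in_image_0: "in_image (\<lambda>i. 0)"
  using in_image_cong[OF in_image_jac[of "\<lambda>i. 0" "\<lambda>i. 0" "\<lambda>i. 0"]] regular.subspace_0[OF ideal]
  by (simp add: jac_0)

text \<open>Linear algebra over the local ring at a prime \<open>m\<close> containing the annihilator of the
  cokernel: \<open>S\<close> consists of the unit vectors outside the localized image.\<close>

lemma obstruction_to_surjectivity:
  assumes "\<not> (\<forall>i\<in>V. in_image (unit_vec i))"
  obtains m S where "prime_ideal m" "S \<noteq> {}" "S \<subseteq> V - U"
    "\<And>i. i \<in> S \<Longrightarrow> a i * prod x (nb i) + 1 \<in> m"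
    "\<And>i j. i \<in> S \<Longrightarrow> j \<in> nb i \<Longrightarrow> \<exists>i'\<in>S. i' \<noteq> i \<and> j \<in> nb i'"
proof -
  \<comment> \<open>The annihilator of the cokernel of the Jacobian modulo \<open>I\<close>; it is a
    proper ideal exactly when surjectivity fails.\<close>
  define K where "K = {c. \<forall>i\<in>V. in_image (\<lambda>l. c * unit_vec i l)}"
  have K: "regular.subspace K"
  proof (rule regular.subspaceI)
    show "0 \<in> K" unfolding K_def using in_image_0 by simp
  next
    fix c e assume "c \<in> K" "e \<in> K"
    then show "c + e \<in> K" unfolding K_def
      using in_image_add[of "\<lambda>l. c * unit_vec _ l" "\<lambda>l. e * unit_vec _ l"] by (simp add: distrib_right)
  next
    fix c e assume "e \<in> K"
    then show "c * e \<in> K" unfolding K_def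
      using in_image_scale[of "\<lambda>l. e * unit_vec _ l" c] by (simp add: mult.assoc)
  qed
  have "1 \<notin> K" using assms unfolding K_def by simp
  with K obtain m where m: "prime_ideal m" "K \<subseteq> m" by (rule prime_ideal_exists)
  note sm = prime_ideal_subspace[OF m(1)]
  have one: "1 \<notin> m" using m(1) unfolding prime_ideal_def by blast
  have "I \<subseteq> K"
  proof
    fix c assume "c \<in> I"
    then have "c * unit_vec i l - 0 \<in> I" for i l using regular.subspace_0[OF ideal] by simp
    then have "in_image (\<lambda>l. c * unit_vec i l)" for i by (rule in_image_cong[OF in_image_0])
    then show "c \<in> K" unfolding K_def by blast
  qed
  then have Im: "I \<subseteq> m" using m(2) by blast
  \<comment> \<open>Membership in the image localized at \<open>m\<close>, with \<open>c\<close> as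
    a common denominator.\<close>
  define loc where "loc f \<longleftrightarrow> (\<exists>c. c \<notin> m \<and> in_image (\<lambda>l. c * f l))" for f
  have loc_image: "loc f" if "in_image f" for f
    unfolding loc_def using that one by (intro exI[of _ 1]) simp
  have loc_add: "loc (\<lambda>l. f l + g l)" if "loc f" "loc g" for f g
  proof -
    from that obtain c e where ce: "c \<notin> m" "in_image (\<lambda>l. c * f l)" "e \<notin> m" "in_image (\<lambda>l. e * g l)"
      unfolding loc_def by blast
    have "in_image (\<lambda>l. e * (c * f l) + c * (e * g l))"
      by (rule in_image_add[OF in_image_scale[OF ce(2)] in_image_scale[OF ce(4)]])
    then have "in_image (\<lambda>l. (c * e) * (f l + g l))" by (simp add: algebra_simps)
    then show ?thesis unfolding loc_def using prime_ideal_mult[OF m(1) ce(1,3)] by blast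
  qed
  have loc_scale: "loc (\<lambda>l. u * f l)" if "loc f" for f u
  proof -
    from that obtain c where c: "c \<notin> m" "in_image (\<lambda>l. c * f l)" unfolding loc_def by blast
    have "in_image (\<lambda>l. c * (u * f l))" using in_image_scale[OF c(2), of u] by (simp add: mult.left_commute)
    then show ?thesis unfolding loc_def using c(1) by blast
  qed
  have loc_unit: "loc f" if "loc (\<lambda>l. u * f l)" "u \<notin> m" for f u
  proof -
    from that(1) obtain c where c: "c \<notin> m" "in_image (\<lambda>l. c * (u * f l))" unfolding loc_def by blast
    have "in_image (\<lambda>l. (c * u) * f l)" using c(2) by (simp add: mult.assoc)
    then show ?thesis unfolding loc_def using prime_ideal_mult[OF m(1) c(1) that(2)] by blast
  qed
  have loc_sum: "loc (\<lambda>l. \<Sum>t\<in>A. u t * unit_vec t l)" if "finite A" "\<And>t. t \<in> A \<Longrightarrow> loc (unit_vec t)" for A u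
    using that
  proof (induction A rule: finite_induct)
    case empty
    then show ?case using loc_image[OF in_image_0] by simp
  next
    case (insert t A)
    then have "loc (\<lambda>l. u t * unit_vec t l + (\<Sum>t\<in>A. u t * unit_vec t l))"
      by (intro loc_add loc_scale) auto
    then show ?case by (simp only: sum.insert[OF insert.hyps])
  qed
  define S where "S = {i\<in>V. \<not> loc (unit_vec i)}"
  \<comment> \<open>Otherwise the product of the denominators of all unit vectors would annihilate
    the cokernel, hence lie in \<open>m\<close>, against primality.\<close>
  have "S \<noteq> {}"
  proof
    assume "S = {}"
    then have "\<forall>i\<in>V. \<exists>c. c \<notin> m \<and> in_image (\<lambda>l. c * unit_vec i l)" unfolding S_def loc_def by blast
    then obtain c where c: "\<And>i. i \<in> V \<Longrightarrow> c i \<notin> m" "\<And>i. i \<in> V \<Longrightarrow> in_image (\<lambda>l. c i * unit_vec i l)" by metis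
    have "in_image (\<lambda>l. prod c V * unit_vec i l)" if "i \<in> V" for i
    proof -
      have "prod c V = prod c (V - {i}) * c i" using that finV by (simp add: prod.remove mult.commute)
      then show ?thesis using in_image_scale[OF c(2)[OF that], of "prod c (V - {i})"] by (simp only: mult.assoc)
    qed
    then have "prod c V \<in> K" unfolding K_def by blast
    then show False using m prime_ideal_prod[OF finV m(1), of c] c(1) by blast
  qed
  \<comment> \<open>The column of \<open>x' i\<close> is \<open>x i\<close> times the unit vector at
    \<open>i\<close>.\<close>
  have xm: "x i \<in> m" if "i \<in> S" for i
  proof (rule ccontr)
    assume "x i \<notin> m"
    have "jac (\<lambda>l. 0) (unit_vec i) (\<lambda>l. 0) = (\<lambda>l. x i * unit_vec i l)"
      unfolding jac_def by auto
    then have "loc (\<lambda>l. x i * unit_vec i l)" using loc_image[OF in_image_jac] by metis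
    then have "loc (unit_vec i)" using \<open>x i \<notin> m\<close> by (rule loc_unit)
    then show False using that unfolding S_def by blast
  qed
  have relm: "a i * prod x (nb i) + 1 \<in> m" if "i \<in> S" for i
  proof -
    have "x i * x' i - (1 + a i * prod x (nb i)) \<in> m" using rel[of i] that Im unfolding S_def by blast
    moreover have "x i * x' i \<in> m" using ideal_dvd[OF sm xm[OF that]] by simp
    ultimately have "x i * x' i - (x i * x' i - (1 + a i * prod x (nb i))) \<in> m"
      by (rule regular.subspace_diff[OF sm, rotated])
    then show ?thesis by (simp add: add.commute)
  qed
  have prodm: "prod x (nb i) \<notin> m" if "i \<in> S" for i
  proof
    assume "prod x (nb i) \<in> m"
    then have "(a i * prod x (nb i) + 1) - a i * prod x (nb i) \<in> m"
      using relm[OF that] by (intro regular.subspace_diff[OF sm] regular.subspace_scale[OF sm])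
    then show False using one by simp
  qed
  have SU: "i \<notin> U" if "i \<in> S" for i
  proof
    assume "i \<in> U"
    then have "jac (\<lambda>l. 0) (\<lambda>l. 0) (unit_vec i) = (\<lambda>l. - prod x (nb i) * unit_vec i l)"
      unfolding jac_def by auto
    then have "loc (\<lambda>l. - prod x (nb i) * unit_vec i l)" using loc_image[OF in_image_jac] by metis
    moreover have "- prod x (nb i) \<notin> m" using prodm[OF that] regular.subspace_neg[OF sm] by force
    ultimately have "loc (unit_vec i)" by (rule loc_unit)
    then show False using that unfolding S_def by blast
  qed
  have two: "\<exists>i'\<in>S. i' \<noteq> i \<and> j \<in> nb i'" if i: "i \<in> S" and j: "j \<in> nb i" for i j
  proof (rule ccontr)
    assume none: "\<not> ?thesis"
    have xj: "x j \<notin> m"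
      using prodm[OF i] ideal_dvd[OF sm, of "x j" "prod x (nb i)"] dvd_prodI[OF finite_nb j] by blast
    have jV: "j \<in> V" using j nbV by blast
    then have locj: "loc (unit_vec j)" using xm[of j] xj unfolding S_def by blast
    \<comment> \<open>Modulo \<open>I\<close>, \<open>w t\<close> is the monomial term of the
      relation at \<open>t\<close>. The factor \<open>x j\<close> in \<open>ent\<close> restores the
      variable lost by differentiation, which makes these terms appear. For \<open>i\<close> in
      \<open>S\<close>, \<open>w i\<close> is congruent to -1 modulo \<open>m\<close>.\<close>
    define w where "w t = x t * x' t - 1" for t
    have ent: "x j * jac (unit_vec j) (\<lambda>l. 0) (\<lambda>l. 0) l
        = x j * x' j * unit_vec j l - (if l \<in> nb j then a l * prod x (nb l) else 0)" for l
    proof -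
      have "(\<Sum>t\<in>nb l. prod x (nb l - {t}) * unit_vec j t) = (if j \<in> nb l then prod x (nb l - {j}) else 0)"
        using finite_nb[of l] by (simp add: if_distrib sum.delta cong: if_cong)
      moreover have "j \<in> nb l \<longleftrightarrow> l \<in> nb j" using sym by blast
      moreover have "x j * (a l * prod x (nb l - {j})) = a l * prod x (nb l)" if "j \<in> nb l"
        unfolding prod.remove[OF finite_nb that, of x] by (rule mult.left_commute)
      ultimately show ?thesis unfolding jac_def
        by (auto simp: right_diff_distrib mult.assoc)
    qed
    have "in_image (\<lambda>l. x j * x' j * unit_vec j l - (\<Sum>t\<in>nb j. w t * unit_vec t l))"
    proof (rule in_image_cong[OF in_image_scale[OF in_image_jac]])
      fix l assume l: "l \<in> V"
      have "(\<Sum>t\<in>nb j. w t * unit_vec t l) = (if l \<in> nb j then w l else 0)"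
        using finite_nb[of j] by (simp add: if_distrib sum.delta' cong: if_cong)
      then have "x j * x' j * unit_vec j l - (\<Sum>t\<in>nb j. w t * unit_vec t l)
          - x j * jac (unit_vec j) (\<lambda>l. 0) (\<lambda>l. 0) l
          = (if l \<in> nb j then - (x l * x' l - (1 + a l * prod x (nb l))) else 0)"
        unfolding ent w_def by simp
      also have "\<dots> \<in> I" using regular.subspace_neg[OF ideal rel[OF l]] regular.subspace_0[OF ideal] by (metis (full_types))
      finally show "x j * x' j * unit_vec j l - (\<Sum>t\<in>nb j. w t * unit_vec t l)
          - x j * jac (unit_vec j) (\<lambda>l. 0) (\<lambda>l. 0) l \<in> I" .
    qed
    then have "loc (\<lambda>l. - 1 * (x j * x' j * unit_vec j l - (\<Sum>t\<in>nb j. w t * unit_vec t l)))"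
      by (intro loc_scale loc_image)
    moreover have "loc (\<lambda>l. x j * x' j * unit_vec j l)" using locj by (rule loc_scale)
    moreover have "loc (\<lambda>l. \<Sum>t\<in>nb j - {i}. - w t * unit_vec t l)"
      using none nbV sym[of _ j] finite_nb unfolding S_def by (intro loc_sum) auto
    ultimately have "loc (\<lambda>l. - 1 * (x j * x' j * unit_vec j l - (\<Sum>t\<in>nb j. w t * unit_vec t l))
        + x j * x' j * unit_vec j l + (\<Sum>t\<in>nb j - {i}. - w t * unit_vec t l))"
      by (intro loc_add)
    moreover have "- 1 * (x j * x' j * unit_vec j l - (\<Sum>t\<in>nb j. w t * unit_vec t l))
        + x j * x' j * unit_vec j l + (\<Sum>t\<in>nb j - {i}. - w t * unit_vec t l) = w i * unit_vec i l" for l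
      using sum.remove[OF finite_nb sym[OF j], of "\<lambda>t. w t * unit_vec t l"]
      by (simp add: sum_negf)
    ultimately have "loc (\<lambda>l. w i * unit_vec i l)" by (simp only:)
    moreover have "w i \<notin> m"
    proof
      assume "w i \<in> m"
      moreover have "x i * x' i \<in> m" using ideal_dvd[OF sm xm[OF i]] by simp
      ultimately have "x i * x' i - w i \<in> m" by (rule regular.subspace_diff[OF sm, rotated])
      then show False using one unfolding w_def by simp
    qed
    ultimately have "loc (unit_vec i)" by (rule loc_unit)
    then show False using i unfolding S_def by blast
  qed
  show thesis
    by (rule that[of m S]) (use m \<open>S \<noteq> {}\<close> SU relm two in \<open>auto simp: S_def\<close>)
qed

text \<open>Newton's step: correct \<open>x, x', a\<close> by \<open>d = - \<Sum>\<^sub>k r\<^sub>k D\<^sub>k\<close> where \<open>r\<^sub>k\<close> are the relations and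
  \<open>D\<^sub>k\<close> is a preimage of the \<open>k\<close>-th unit vector under the Jacobian.\<close>

lemma newton_step:
  assumes "\<forall>i\<in>V. in_image (unit_vec i)"
  obtains y y' b where "\<And>i. y i - x i \<in> I" "\<And>i. y' i - x' i \<in> I" "\<And>i. b i - a i \<in> I"
    "\<And>i. i \<notin> U \<Longrightarrow> b i = a i"
    "\<And>i. i \<in> V \<Longrightarrow> y i * y' i - (1 + b i * prod y (nb i)) \<in> ideal_square I"
proof -
  have "\<forall>k\<in>V. \<exists>d d' da. \<forall>i\<in>V. unit_vec k i - jac d d' da i \<in> I"
    using assms unfolding in_image_def by blast
  then obtain D D' DA where D: "\<And>k i. k \<in> V \<Longrightarrow> i \<in> V \<Longrightarrow> unit_vec k i - jac (D k) (D' k) (DA k) i \<in> I"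
    by metis
  define r where "r i = x i * x' i - (1 + a i * prod x (nb i))" for i
  define d where "d i = (\<Sum>k\<in>V. - r k * D k i)" for i
  define d' where "d' i = (\<Sum>k\<in>V. - r k * D' k i)" for i
  define da where "da i = (\<Sum>k\<in>V. - r k * DA k i)" for i
  define y where "y i = x i + d i" for i
  define y' where "y' i = x' i + d' i" for i
  \<comment> \<open>Outside \<open>U\<close> the coefficient must stay fixed: a substitution of
    variables cannot move a constant.\<close>
  define b where "b i = a i + (if i \<in> U then da i else 0)" for i
  have rI: "r i \<in> I" if "i \<in> V" for i using rel[OF that] unfolding r_def .
  have inI: "(\<Sum>k\<in>V. - r k * F k) \<in> I" for F
  proof (rule regular.subspace_sum[OF ideal])
    fix k assume "k \<in> V"
    then show "- r k * F k \<in> I" by (rule ideal_dvd[OF ideal rI]) simp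
  qed
  then have dI: "d i \<in> I" "d' i \<in> I" "da i \<in> I" for i unfolding d_def d'_def da_def by simp_all
  note I2 = ideal_square_subspace[of I]
  have "y i * y' i - (1 + b i * prod y (nb i)) \<in> ideal_square I" if i: "i \<in> V" for i
  proof -
    let ?e = "if i \<in> U then da i else 0"
    let ?L = "\<Sum>j\<in>nb i. prod x (nb i - {j}) * d j" and ?P = "prod x (nb i)"
    define q where "q = prod y (nb i) - (?P + ?L)"
    have q: "q \<in> ideal_square I"
      unfolding q_def y_def using prod_perturb[OF ideal finite_nb] dI by blast
    have "?L \<in> I" using dI ideal by (intro regular.subspace_sum regular.subspace_scale) auto
    moreover have "?e \<in> I" using dI regular.subspace_0[OF ideal] by simp
    ultimately have eL: "?e * ?L \<in> ideal_square I" by (rule ideal_square_mult[rotated])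
    have dd: "d i * d' i \<in> ideal_square I" using dI by (intro ideal_square_mult)
    have "jac d d' da i = (\<Sum>k\<in>V. - r k * jac (D k) (D' k) (DA k) i)"
      unfolding d_def d'_def da_def by (rule jac_sum[OF finV])
    moreover have "r i = (\<Sum>k\<in>V. r k * unit_vec k i)"
      using i finV by (simp add: if_distrib sum.delta' cong: if_cong)
    \<comment> \<open>Each summand is a relation times the error of a preimage, hence a product of
      two elements of \<open>I\<close>.\<close>
    ultimately have "r i + jac d d' da i = (\<Sum>k\<in>V. r k * (unit_vec k i - jac (D k) (D' k) (DA k) i))"
      by (simp add: sum_subtractf sum_negf right_diff_distrib)
    also have "\<dots> \<in> ideal_square I"
      using rI D i by (intro regular.subspace_sum[OF I2] ideal_square_mult) auto
    finally have rj: "r i + jac d d' da i \<in> ideal_square I" .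
    have py: "prod y (nb i) = ?P + ?L + q" unfolding q_def by simp
    have "(if i \<in> U then ?P * da i else 0) = ?P * ?e" by simp
    then have "y i * y' i - (1 + b i * prod y (nb i)) = (r i + jac d d' da i) + d i * d' i - ?e * ?L - b i * q"
      unfolding py jac_def r_def unfolding y_def y'_def b_def by (simp add: algebra_simps)
    also have "\<dots> \<in> ideal_square I"
      by (rule regular.subspace_diff[OF I2 regular.subspace_diff[OF I2 regular.subspace_add[OF I2 rj dd] eL]
            regular.subspace_scale[OF I2 q]])
    finally show ?thesis .
  qed
  then show ?thesis
    using that[of y y' b] dI regular.subspace_0[OF ideal] unfolding y_def y'_def b_def by simp
qed

end

section \<open>Polynomial rings, quotients and smoothness\<close>

lemma poly_mapping_add_induct [case_names zero add]:
  assumes "P 0"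
    and step: "\<And>f a b. P f \<Longrightarrow> a \<notin> Poly_Mapping.keys f \<Longrightarrow> b \<noteq> 0 \<Longrightarrow> P (f + Poly_Mapping.single a b)"
  shows "P (f :: 'a \<Rightarrow>\<^sub>0 'b::comm_monoid_add)"
proof (induction f rule: update_induct)
  case const
  show ?case by fact
next
  case (update f a b)
  have "Poly_Mapping.update a b f = f + Poly_Mapping.single a b"
    using update by (intro poly_mapping_eqI) (auto simp: lookup_update lookup_add lookup_single in_keys_iff when_def)
  then show ?case using update step by metis
qed

text \<open>A fresh term cannot cancel, so the support of \<open>f\<close> stays inside that of the
  sum; inductions over polynomials thereby remain in \<open>mpoly_ring Vs\<close>.\<close>

lemma keys_add_single:
  assumes "a \<notin> Poly_Mapping.keys f" "b \<noteq> (0 :: 'b::comm_monoid_add)"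
  shows "Poly_Mapping.keys (f + Poly_Mapping.single a b) = insert a (Poly_Mapping.keys f)"
  using assms by (auto simp: in_keys_iff lookup_add lookup_single when_def split: if_splits)

lemma mpoly_ring_simps [simp]:
  "x \<otimes>\<^bsub>mpoly_ring Vs\<^esub> y = x * y" "x \<oplus>\<^bsub>mpoly_ring Vs\<^esub> y = x + y"
  "\<one>\<^bsub>mpoly_ring Vs\<^esub> = 1" "\<zero>\<^bsub>mpoly_ring Vs\<^esub> = 0"
  unfolding mpoly_ring_def by simp_all

lemma base_ring_simps [simp]:
  "carrier base_ring = UNIV" "x \<otimes>\<^bsub>base_ring\<^esub> y = x * y" "x \<oplus>\<^bsub>base_ring\<^esub> y = x + y"
  "\<one>\<^bsub>base_ring\<^esub> = 1" "\<zero>\<^bsub>base_ring\<^esub> = 0"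
  unfolding base_ring_def by simp_all

lemma mpoly_ring_carrier: "p \<in> carrier (mpoly_ring Vs) \<longleftrightarrow> (\<forall>m\<in>Poly_Mapping.keys p. Poly_Mapping.keys m \<subseteq> Vs)"
  unfolding mpoly_ring_def by simp

lemma mpoly_ring_carrier_UNIV [simp]: "carrier (mpoly_ring UNIV) = UNIV"
  unfolding mpoly_ring_def by simp

lemma mpoly_ring_mult_closed:
  assumes "p \<in> carrier (mpoly_ring Vs)" "q \<in> carrier (mpoly_ring Vs)"
  shows "p * q \<in> carrier (mpoly_ring Vs)"
  unfolding mpoly_ring_carrier
proof
  fix m assume "m \<in> Poly_Mapping.keys (p * q)"
  then obtain a b where "m = a + b" "a \<in> Poly_Mapping.keys p" "b \<in> Poly_Mapping.keys q"
    using keys_mult by blast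
  then show "Poly_Mapping.keys m \<subseteq> Vs"
    using keys_add[of a b] assms unfolding mpoly_ring_carrier by blast
qed

lemma mpoly_ring_add_closed:
  "p \<in> carrier (mpoly_ring Vs) \<Longrightarrow> q \<in> carrier (mpoly_ring Vs) \<Longrightarrow> p + q \<in> carrier (mpoly_ring Vs)"
  using keys_add[of p q] unfolding mpoly_ring_carrier by blast

lemma mpoly_ring_uminus_closed: "p \<in> carrier (mpoly_ring Vs) \<Longrightarrow> - p \<in> carrier (mpoly_ring Vs)"
  unfolding mpoly_ring_carrier by simp

lemma mpoly_ring_diff_closed:
  "p \<in> carrier (mpoly_ring Vs) \<Longrightarrow> q \<in> carrier (mpoly_ring Vs) \<Longrightarrow> p - q \<in> carrier (mpoly_ring Vs)"
  using mpoly_ring_add_closed[of p Vs "- q"] mpoly_ring_uminus_closed[of q Vs] by simp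

lemma mpoly_const_closed [simp]: "mpoly_const c \<in> carrier (mpoly_ring Vs)"
  unfolding mpoly_ring_carrier mpoly_const_def by simp

lemma mpoly_var_closed: "v \<in> Vs \<Longrightarrow> mpoly_var v \<in> carrier (mpoly_ring Vs)"
  unfolding mpoly_ring_carrier mpoly_var_def by simp

lemma mpoly_const_1: "mpoly_const 1 = 1" and mpoly_const_0: "mpoly_const 0 = 0"
  and mpoly_const_mult: "mpoly_const (c * d) = mpoly_const c * mpoly_const d"
  and mpoly_const_add: "mpoly_const (c + d) = mpoly_const c + mpoly_const d"
  unfolding mpoly_const_def by (simp_all add: mult_single single_add)

lemma mpoly_ring_one_closed: "1 \<in> carrier (mpoly_ring Vs)"
  using mpoly_const_closed[of 1] by (simp add: mpoly_const_1)

lemma mpoly_ring_prod_closed: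
  "(\<And>i. i \<in> A \<Longrightarrow> f i \<in> carrier (mpoly_ring Vs)) \<Longrightarrow> prod f A \<in> carrier (mpoly_ring Vs)"
  by (induction A rule: infinite_finite_induct) (auto intro: mpoly_ring_mult_closed mpoly_ring_one_closed)

lemma mpoly_ring_cring: "cring (mpoly_ring Vs)"
proof (rule cringI)
  have 0: "0 \<in> carrier (mpoly_ring Vs)" using mpoly_const_closed[of 0] by (simp add: mpoly_const_0)
  show "abelian_group (mpoly_ring Vs)"
  proof (rule abelian_groupI)
    fix p assume "p \<in> carrier (mpoly_ring Vs)"
    then show "\<exists>q\<in>carrier (mpoly_ring Vs). q \<oplus>\<^bsub>mpoly_ring Vs\<^esub> p = \<zero>\<^bsub>mpoly_ring Vs\<^esub>"
      by (intro bexI[of _ "- p"]) (auto simp: mpoly_ring_uminus_closed)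
  qed (auto simp: 0 mpoly_ring_add_closed ac_simps)
  show "Group.comm_monoid (mpoly_ring Vs)"
    by (rule comm_monoidI) (auto simp: mpoly_ring_mult_closed mpoly_ring_one_closed ac_simps)
qed (auto simp: distrib_right)

lemma mpoly_const_hom: "mpoly_const \<in> ring_hom base_ring (mpoly_ring Vs)"
  by (rule ring_hom_memI) (auto simp: mpoly_const_mult mpoly_const_add mpoly_const_1)

text \<open>Uniqueness half of the universal property: agreement spreads from variables to powers,
  monomials and sums. It identifies composite homomorphisms without computing evaluations.\<close>

lemma mpoly_hom_unique:
  assumes f: "f \<in> ring_hom (mpoly_ring Vs) S" and g: "g \<in> ring_hom (mpoly_ring Vs) S"
    and const: "\<And>c. f (mpoly_const c) = g (mpoly_const c)"
    and var: "\<And>v. v \<in> Vs \<Longrightarrow> f (mpoly_var v) = g (mpoly_var v)"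
    and p: "p \<in> carrier (mpoly_ring Vs)"
  shows "f p = g p"
proof -
  let ?P = "carrier (mpoly_ring Vs)"
  have hom_mult: "f (p * q) = g (p * q)" if "p \<in> ?P" "q \<in> ?P" "f p = g p" "f q = g q" for p q
    using ring_hom_mult[OF f that(1,2)] ring_hom_mult[OF g that(1,2)] that(3,4) by simp
  have hom_add: "f (p + q) = g (p + q)" if "p \<in> ?P" "q \<in> ?P" "f p = g p" "f q = g q" for p q
    using ring_hom_add[OF f that(1,2)] ring_hom_add[OF g that(1,2)] that(3,4) by simp
  have mono_closed: "Poly_Mapping.single m c \<in> ?P" if "Poly_Mapping.keys m \<subseteq> Vs" for m and c :: 'b
    using that unfolding mpoly_ring_carrier by auto
  have power: "f (Poly_Mapping.single (Poly_Mapping.single v n) 1) = g (Poly_Mapping.single (Poly_Mapping.single v n) 1)"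
    if v: "v \<in> Vs" for v n
  proof (induction n)
    case 0
    then show ?case using const[of 1] unfolding mpoly_const_def by simp
  next
    case (Suc n)
    have "Poly_Mapping.single (Poly_Mapping.single v (Suc n)) 1
        = mpoly_var v * Poly_Mapping.single (Poly_Mapping.single v n) (1 :: 'b)"
      unfolding mpoly_var_def mult_single by (simp flip: single_add)
    then show ?case
      using hom_mult[OF mpoly_var_closed[OF v] _ var[OF v] Suc] v by (simp add: mono_closed)
  qed
  have mono: "f (Poly_Mapping.single m 1) = g (Poly_Mapping.single m 1)" if "Poly_Mapping.keys m \<subseteq> Vs" for m
    using that
  proof (induction m rule: poly_mapping_add_induct)
    case zero
    then show ?case using const[of 1] unfolding mpoly_const_def by simp
  next
    case (add m v n)
    have k: "Poly_Mapping.keys m \<subseteq> Vs" "v \<in> Vs" using add keys_add_single[of v m n] by auto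
    have "Poly_Mapping.single (m + Poly_Mapping.single v n) 1
        = Poly_Mapping.single m 1 * Poly_Mapping.single (Poly_Mapping.single v n) (1 :: 'b)"
      unfolding mult_single by simp
    then show ?case
      using hom_mult[OF _ _ add.IH[OF k(1)] power[OF k(2)]] k by (simp add: mono_closed)
  qed
  show ?thesis
    using p
  proof (induction p rule: poly_mapping_add_induct)
    case zero
    then show ?case using const[of 0] by (simp add: mpoly_const_0)
  next
    case (add p m c)
    have k: "p \<in> ?P" "Poly_Mapping.keys m \<subseteq> Vs"
      using add keys_add_single[of m p c] unfolding mpoly_ring_carrier by auto
    have "Poly_Mapping.single m c = mpoly_const c * Poly_Mapping.single m 1"
      unfolding mpoly_const_def mult_single by simp
    then have "f (Poly_Mapping.single m c) = g (Poly_Mapping.single m c)"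
      using hom_mult[OF mpoly_const_closed mono_closed[OF k(2)] const mono[OF k(2)]] by simp
    then show ?case by (rule hom_add[OF k(1) mono_closed[OF k(2)] add.IH[OF k(1)]])
  qed
qed

section \<open>Evaluation homomorphisms\<close>

definition mono_eval :: "('s, 'm) ring_scheme \<Rightarrow> ('v \<Rightarrow> 's) \<Rightarrow> ('v \<Rightarrow>\<^sub>0 nat) \<Rightarrow> 's" where
  "mono_eval S b m = (\<Otimes>\<^bsub>S\<^esub>v\<in>Poly_Mapping.keys m. b v [^]\<^bsub>S\<^esub> Poly_Mapping.lookup m v)"

text \<open>Existence half of the universal property. The target is a ring with a carrier because
  the test algebra \<open>B\<close> of formal smoothness is one; \<open>b\<close> is total, so a
  single map serves every set of variables.\<close>

definition mpoly_eval ::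
    "('s, 'm) ring_scheme \<Rightarrow> ('k::comm_ring_1 \<Rightarrow> 's) \<Rightarrow> ('v \<Rightarrow> 's) \<Rightarrow> ('v, 'k) mpoly \<Rightarrow> 's" where
  "mpoly_eval S \<theta> b p = (\<Oplus>\<^bsub>S\<^esub>m\<in>Poly_Mapping.keys p. \<theta> (Poly_Mapping.lookup p m) \<otimes>\<^bsub>S\<^esub> mono_eval S b m)"

context
  fixes S :: "('s, 'm) ring_scheme" (structure) and \<theta> :: "'k::comm_ring_1 \<Rightarrow> 's" and b :: "'v \<Rightarrow> 's"
  assumes S: "cring S" and \<theta>: "\<theta> \<in> ring_hom base_ring S" and b: "\<And>v. b v \<in> carrier S"
begin

interpretation S: cring S by (rule S)

lemma base_hom:
  "\<theta> c \<in> carrier S" "\<theta> (c * d) = \<theta> c \<otimes> \<theta> d" "\<theta> (c + d) = \<theta> c \<oplus> \<theta> d" "\<theta> 1 = \<one>" "\<theta> 0 = \<zero>"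
proof -
  show 1: "\<theta> c \<in> carrier S" for c using ring_hom_closed[OF \<theta>, of c] by simp
  show "\<theta> (c * d) = \<theta> c \<otimes> \<theta> d" using ring_hom_mult[OF \<theta>, of c d] by simp
  show 2: "\<theta> (c + d) = \<theta> c \<oplus> \<theta> d" for c d using ring_hom_add[OF \<theta>, of c d] by simp
  show "\<theta> 1 = \<one>" using ring_hom_one[OF \<theta>] by simp
  show "\<theta> 0 = \<zero>" using 2[of 0 0] 1[of 0] by simp
qed

lemma mono_eval_superset:
  "finite A \<Longrightarrow> Poly_Mapping.keys m \<subseteq> A \<Longrightarrow> mono_eval S b m = (\<Otimes>v\<in>A. b v [^] Poly_Mapping.lookup m v)"
  unfolding mono_eval_def using b
  by (intro S.finprod_mono_neutral_cong_left) (auto simp: in_keys_iff)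

lemma mono_eval_closed: "mono_eval S b m \<in> carrier S"
  unfolding mono_eval_def using b by (intro S.finprod_closed) auto

lemma mono_eval_add: "mono_eval S b (m + n) = mono_eval S b m \<otimes> mono_eval S b n"
proof -
  let ?A = "Poly_Mapping.keys m \<union> Poly_Mapping.keys n"
  have "mono_eval S b (m + n) = (\<Otimes>v\<in>?A. b v [^] (Poly_Mapping.lookup m v + Poly_Mapping.lookup n v))"
    using mono_eval_superset[of ?A "m + n"] keys_add[of m n] by (simp add: lookup_add)
  also have "\<dots> = (\<Otimes>v\<in>?A. b v [^] Poly_Mapping.lookup m v \<otimes> b v [^] Poly_Mapping.lookup n v)"
    using b by (simp add: S.nat_pow_mult)
  also have "\<dots> = mono_eval S b m \<otimes> mono_eval S b n"
    using b mono_eval_superset[of ?A m] mono_eval_superset[of ?A n] by (simp add: S.finprod_multf)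
  finally show ?thesis .
qed

lemma mpoly_eval_superset:
  "finite A \<Longrightarrow> Poly_Mapping.keys p \<subseteq> A \<Longrightarrow>
    mpoly_eval S \<theta> b p = (\<Oplus>m\<in>A. \<theta> (Poly_Mapping.lookup p m) \<otimes> mono_eval S b m)"
  unfolding mpoly_eval_def using mono_eval_closed base_hom(1)
  by (intro S.add.finprod_mono_neutral_cong_left) (auto simp: in_keys_iff base_hom(5))

lemma mpoly_eval_closed: "mpoly_eval S \<theta> b p \<in> carrier S"
  unfolding mpoly_eval_def using mono_eval_closed base_hom(1) by (intro S.finsum_closed) auto

lemma mpoly_eval_add: "mpoly_eval S \<theta> b (p + q) = mpoly_eval S \<theta> b p \<oplus> mpoly_eval S \<theta> b q"
proof -
  let ?A = "Poly_Mapping.keys p \<union> Poly_Mapping.keys q"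
  have "mpoly_eval S \<theta> b (p + q)
      = (\<Oplus>m\<in>?A. \<theta> (Poly_Mapping.lookup p m) \<otimes> mono_eval S b m \<oplus> \<theta> (Poly_Mapping.lookup q m) \<otimes> mono_eval S b m)"
    using mpoly_eval_superset[of ?A "p + q"] keys_add[of p q] mono_eval_closed base_hom(1)
    by (simp add: lookup_add base_hom(3) S.l_distr)
  also have "\<dots> = mpoly_eval S \<theta> b p \<oplus> mpoly_eval S \<theta> b q"
    using mpoly_eval_superset[of ?A p] mpoly_eval_superset[of ?A q] mono_eval_closed base_hom(1)
    by (simp add: S.finsum_addf)
  finally show ?thesis .
qed

lemma mpoly_eval_single: "mpoly_eval S \<theta> b (Poly_Mapping.single m c) = \<theta> c \<otimes> mono_eval S b m"
  using mpoly_eval_superset[of "{m}" "Poly_Mapping.single m c"] mono_eval_closed base_hom(1)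
  by (simp add: S.finsum_singleton)

lemma mpoly_eval_0: "mpoly_eval S \<theta> b 0 = \<zero>"
  unfolding mpoly_eval_def by simp

lemma mpoly_eval_mult: "mpoly_eval S \<theta> b (p * q) = mpoly_eval S \<theta> b p \<otimes> mpoly_eval S \<theta> b q"
proof (induction p rule: poly_mapping_add_induct)
  case zero
  then show ?case by (simp add: mpoly_eval_0 mpoly_eval_closed)
next
  case (add p m c)
  have "mpoly_eval S \<theta> b (Poly_Mapping.single m c * q) = mpoly_eval S \<theta> b (Poly_Mapping.single m c) \<otimes> mpoly_eval S \<theta> b q"
  proof (induction q rule: poly_mapping_add_induct)
    case zero
    then show ?case by (simp add: mpoly_eval_0 mpoly_eval_closed)
  next
    case (add q n d)
    have "mpoly_eval S \<theta> b (Poly_Mapping.single m c * Poly_Mapping.single n d)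
        = mpoly_eval S \<theta> b (Poly_Mapping.single m c) \<otimes> mpoly_eval S \<theta> b (Poly_Mapping.single n d)"
      unfolding mult_single mpoly_eval_single mono_eval_add base_hom(2)
      using mono_eval_closed base_hom(1) by (simp add: S.m_ac)
    then show ?case by (simp add: distrib_left mpoly_eval_add add.IH S.r_distr mpoly_eval_closed)
  qed
  then show ?case by (simp add: distrib_right mpoly_eval_add add.IH S.l_distr mpoly_eval_closed)
qed

lemma mpoly_eval_const: "mpoly_eval S \<theta> b (mpoly_const c) = \<theta> c"
  unfolding mpoly_const_def mpoly_eval_single by (simp add: mono_eval_def base_hom(1))

lemma mpoly_eval_var: "mpoly_eval S \<theta> b (mpoly_var v) = b v"
  unfolding mpoly_var_def mpoly_eval_single using b
  by (simp add: mono_eval_def base_hom(1,4))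

lemma mpoly_eval_hom: "mpoly_eval S \<theta> b \<in> ring_hom (mpoly_ring Vs) S"
  using mpoly_eval_const[of 1]
  by (intro ring_hom_memI) (simp_all add: mpoly_eval_closed mpoly_eval_add mpoly_eval_mult mpoly_const_1 base_hom(4))

end

section \<open>Homomorphisms out of quotients\<close>

lemma quotient_hom_factor:
  assumes R: "ring R" and I: "ideal I R" and S: "ring S" and h: "h \<in> ring_hom R S"
    and zero: "\<And>p. p \<in> I \<Longrightarrow> h p = \<zero>\<^bsub>S\<^esub>"
  obtains hb where "hb \<in> ring_hom (R Quot I) S" "\<And>p. p \<in> carrier R \<Longrightarrow> hb (I +>\<^bsub>R\<^esub> p) = h p"
proof -
  interpret R: ring R by (rule R)
  interpret S: ring S by (rule S)
  interpret I: ideal I R by (rule I)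
  interpret h: ring_hom_ring R S h using R S h by (rule ring_hom_ringI2)
  have wd: "h p = h q" if "p \<in> carrier R" "q \<in> carrier R" "I +>\<^bsub>R\<^esub> p = I +>\<^bsub>R\<^esub> q" for p q
  proof -
    have d: "p \<ominus>\<^bsub>R\<^esub> q \<in> I" using R.quotient_eq_iff_same_a_r_cos[OF I that(1,2)] that(3) by simp
    have "p = (p \<ominus>\<^bsub>R\<^esub> q) \<oplus>\<^bsub>R\<^esub> q" using that by (simp add: R.minus_eq R.a_assoc R.l_neg)
    then have "h p = h (p \<ominus>\<^bsub>R\<^esub> q) \<oplus>\<^bsub>S\<^esub> h q" using that by (metis R.minus_closed h.hom_add)
    then show ?thesis using zero[OF d] that by simp
  qed
  define hb where "hb X = h (SOME p. p \<in> carrier R \<and> X = I +>\<^bsub>R\<^esub> p)" for X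
  have hb: "hb (I +>\<^bsub>R\<^esub> p) = h p" if p: "p \<in> carrier R" for p
  proof -
    let ?q = "SOME q. q \<in> carrier R \<and> I +>\<^bsub>R\<^esub> p = I +>\<^bsub>R\<^esub> q"
    have "?q \<in> carrier R \<and> I +>\<^bsub>R\<^esub> p = I +>\<^bsub>R\<^esub> ?q" by (rule someI[of _ p]) (simp add: p)
    then show ?thesis unfolding hb_def using wd[of p ?q] p by simp
  qed
  note H = I.rcos_ring_hom
  have rep: "\<exists>p\<in>carrier R. X = I +>\<^bsub>R\<^esub> p" if "X \<in> carrier (R Quot I)" for X
    using that unfolding FactRing_simps by auto
  have "hb \<in> ring_hom (R Quot I) S"
  proof (rule ring_hom_memI)
    fix X assume "X \<in> carrier (R Quot I)"
    then show "hb X \<in> carrier S" using rep hb h.hom_closed by metis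
  next
    fix X Y assume "X \<in> carrier (R Quot I)" "Y \<in> carrier (R Quot I)"
    then obtain p q where pq: "p \<in> carrier R" "X = I +>\<^bsub>R\<^esub> p" "q \<in> carrier R" "Y = I +>\<^bsub>R\<^esub> q"
      using rep by metis
    show "hb (X \<otimes>\<^bsub>R Quot I\<^esub> Y) = hb X \<otimes>\<^bsub>S\<^esub> hb Y"
      using ring_hom_mult[OF H pq(1,3)] pq hb by (metis R.m_closed h.hom_mult)
    show "hb (X \<oplus>\<^bsub>R Quot I\<^esub> Y) = hb X \<oplus>\<^bsub>S\<^esub> hb Y"
      using ring_hom_add[OF H pq(1,3)] pq hb by (metis R.a_closed h.hom_add)
  next
    show "hb \<one>\<^bsub>R Quot I\<^esub> = \<one>\<^bsub>S\<^esub>" using ring_hom_one[OF H] hb[OF R.one_closed] by simp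
  qed
  then show thesis using hb by (rule that)
qed

text \<open>The preimage of \<open>J\<close> is an ideal containing \<open>F\<close>. With
  \<open>J\<close> zero this gives vanishing on the generated ideal; with \<open>J\<close> a
  generated ideal it compares presentations.\<close>

lemma hom_kills_generated_ideal:
  assumes "cring R" "ring S" "h \<in> ring_hom R S" "F \<subseteq> carrier R" "\<And>r. r \<in> F \<Longrightarrow> h r \<in> J" "ideal J S"
  shows "p \<in> Idl\<^bsub>R\<^esub> F \<Longrightarrow> h p \<in> J"
proof -
  interpret R: cring R by fact
  interpret h: ring_hom_ring R S h using R.ring_axioms assms(2,3) by (rule ring_hom_ringI2)
  have "Idl\<^bsub>R\<^esub> F \<subseteq> {r \<in> carrier R. h r \<in> J}"
    by (rule R.genideal_minimal[OF h.ideal_vimage[OF assms(6)]]) (use assms(4,5) in auto)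
  then show "p \<in> Idl\<^bsub>R\<^esub> F \<Longrightarrow> h p \<in> J" by blast
qed

lemma is_algebra_quotient:
  assumes "F \<subseteq> carrier (mpoly_ring Vs)"
  defines "I \<equiv> Idl\<^bsub>mpoly_ring Vs\<^esub> F"
  shows "is_algebra (mpoly_ring Vs Quot I) (\<lambda>c. I +>\<^bsub>mpoly_ring Vs\<^esub> mpoly_const c)"
proof -
  interpret P: cring "mpoly_ring Vs :: ('a, 'b) mpoly ring" by (rule mpoly_ring_cring)
  interpret I: ideal I "mpoly_ring Vs" unfolding I_def using assms(1) by (rule P.genideal_ideal)
  show ?thesis
    unfolding is_algebra_def
    using I.quotient_is_cring[OF P.is_cring] ring_hom_trans[OF mpoly_const_hom I.rcos_ring_hom]
    by (simp add: o_def)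
qed

text \<open>A finite presentation in the sense of the definition uses the variables \<open>0, \<dots>, n - 1\<close>; the
  variables in \<open>Vs\<close> are renamed to these.\<close>

lemma finitely_presented_quotient:
  fixes F :: "('v, 'k::comm_ring_1) mpoly set"
  assumes Vs: "finite Vs" and F: "finite F" "F \<subseteq> carrier (mpoly_ring Vs)"
  defines "I \<equiv> Idl\<^bsub>mpoly_ring Vs\<^esub> F"
  shows "finitely_presented (mpoly_ring Vs Quot I) (\<lambda>c. I +>\<^bsub>mpoly_ring Vs\<^esub> mpoly_const c)"
proof -
  let ?P = "mpoly_ring Vs :: ('v, 'k) mpoly ring"
  interpret P: cring ?P by (rule mpoly_ring_cring)
  interpret I: ideal I ?P unfolding I_def using F(2) by (rule P.genideal_ideal)
  define n where "n = card Vs"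
  let ?N = "mpoly_ring {..<n} :: (nat, 'k) mpoly ring"
  interpret N: cring ?N by (rule mpoly_ring_cring)
  obtain \<sigma> where \<sigma>: "bij_betw \<sigma> {..<n} Vs"
    using ex_bij_betw_nat_finite[OF Vs] unfolding n_def atLeast0LessThan by blast
  define \<tau> where "\<tau> = inv_into {..<n} \<sigma>"
  have \<tau>: "\<tau> v \<in> {..<n}" "\<sigma> (\<tau> v) = v" if "v \<in> Vs" for v
    using \<sigma> that unfolding \<tau>_def bij_betw_def by (metis inv_into_into, metis f_inv_into_f)
  have \<sigma>V: "\<sigma> i \<in> Vs" "\<tau> (\<sigma> i) = i" if "i \<in> {..<n}" for i
    using \<sigma> that unfolding \<tau>_def bij_betw_def by auto
  \<comment> \<open>The default 0 keeps the values in the carrier at indices that do not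
    occur.\<close>
  define s :: "nat \<Rightarrow> ('v, 'k) mpoly" where "s i = (if i \<in> {..<n} then mpoly_var (\<sigma> i) else 0)" for i
  define t :: "'v \<Rightarrow> (nat, 'k) mpoly" where "t v = (if v \<in> Vs then mpoly_var (\<tau> v) else 0)" for v
  define \<rho> where "\<rho> = mpoly_eval ?P mpoly_const s"
  define \<rho>' where "\<rho>' = mpoly_eval ?N mpoly_const t"
  have cl: "s i \<in> carrier ?P" for i
    unfolding s_def using \<sigma>V P.zero_closed by (auto intro: mpoly_var_closed)
  have cl': "t v \<in> carrier ?N" for v
    unfolding t_def using \<tau> N.zero_closed by (auto intro: mpoly_var_closed)
  have \<rho>: "\<rho> \<in> ring_hom ?N ?P" "\<And>c. \<rho> (mpoly_const c) = mpoly_const c"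
      "\<And>i. i \<in> {..<n} \<Longrightarrow> \<rho> (mpoly_var i) = mpoly_var (\<sigma> i)"
    unfolding \<rho>_def
    using mpoly_eval_hom[where b = s, OF P.is_cring mpoly_const_hom cl]
      mpoly_eval_const[where b = s, OF P.is_cring mpoly_const_hom cl]
      mpoly_eval_var[where b = s, OF P.is_cring mpoly_const_hom cl] by (auto simp: s_def)
  have \<rho>': "\<rho>' \<in> ring_hom ?P ?N" "\<And>c. \<rho>' (mpoly_const c) = mpoly_const c"
      "\<And>v. v \<in> Vs \<Longrightarrow> \<rho>' (mpoly_var v) = mpoly_var (\<tau> v)"
    unfolding \<rho>'_def
    using mpoly_eval_hom[where b = t, OF N.is_cring mpoly_const_hom cl']
      mpoly_eval_const[where b = t, OF N.is_cring mpoly_const_hom cl']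
      mpoly_eval_var[where b = t, OF N.is_cring mpoly_const_hom cl'] by (auto simp: t_def)
  have id_hom: "id \<in> ring_hom R R" for R :: "'z ring" by (rule ring_hom_memI) auto
  have \<rho>\<rho>': "\<rho> (\<rho>' p) = p" if "p \<in> carrier ?P" for p
    using mpoly_hom_unique[OF ring_hom_trans[OF \<rho>'(1) \<rho>(1)] id_hom _ _ that] \<rho> \<rho>' \<tau> by simp
  have \<rho>'\<rho>: "\<rho>' (\<rho> p) = p" if "p \<in> carrier ?N" for p
    using mpoly_hom_unique[OF ring_hom_trans[OF \<rho>(1) \<rho>'(1)] id_hom _ _ that] \<rho> \<rho>' \<sigma>V by simp
  define h where "h = (+>\<^bsub>?P\<^esub>) I \<circ> \<rho>"
  have h: "h \<in> ring_hom ?N (?P Quot I)" unfolding h_def by (rule ring_hom_trans[OF \<rho>(1) I.rcos_ring_hom])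
  have surj: "h ` carrier ?N = carrier (?P Quot I)"
  proof
    show "h ` carrier ?N \<subseteq> carrier (?P Quot I)" using ring_hom_closed[OF h] by auto
    show "carrier (?P Quot I) \<subseteq> h ` carrier ?N"
    proof
      fix X assume "X \<in> carrier (?P Quot I)"
      then obtain p where p: "p \<in> carrier ?P" "X = I +>\<^bsub>?P\<^esub> p" unfolding FactRing_simps by auto
      then have "X = h (\<rho>' p)" unfolding h_def using \<rho>\<rho>' by simp
      then show "X \<in> h ` carrier ?N" using ring_hom_closed[OF \<rho>'(1) p(1)] by blast
    qed
  qed
  have F': "\<rho>' ` F \<subseteq> carrier ?N" using F(2) ring_hom_closed[OF \<rho>'(1)] by auto
  interpret I': ideal "Idl\<^bsub>?N\<^esub> (\<rho>' ` F)" ?N using F' by (rule N.genideal_ideal)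
  have FI: "F \<subseteq> I" unfolding I_def using F(2) by (rule P.genideal_self)
  have ker: "a_kernel ?N (?P Quot I) h = {q \<in> carrier ?N. \<rho> q \<in> I}"
  proof -
    have "I +>\<^bsub>?P\<^esub> p = I \<longleftrightarrow> p \<in> I" if "p \<in> carrier ?P" for p
      using I.rcos_const_imp_mem[OF that] P.a_rcos_zero[OF I.is_ideal] by blast
    moreover have "\<zero>\<^bsub>?P Quot I\<^esub> = I" unfolding FactRing_def by simp
    ultimately show ?thesis
      unfolding a_kernel_def' h_def using ring_hom_closed[OF \<rho>(1)] by auto
  qed
  also have "\<dots> = Idl\<^bsub>?N\<^esub> (\<rho>' ` F)"
  proof
    show "Idl\<^bsub>?N\<^esub> (\<rho>' ` F) \<subseteq> {q \<in> carrier ?N. \<rho> q \<in> I}"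
    proof
      fix q assume q: "q \<in> Idl\<^bsub>?N\<^esub> (\<rho>' ` F)"
      have "\<rho> q \<in> I"
        by (rule hom_kills_generated_ideal[OF N.is_cring P.ring_axioms \<rho>(1) F' _ I.is_ideal q])
           (use FI \<rho>\<rho>' F(2) in auto)
      then show "q \<in> {q \<in> carrier ?N. \<rho> q \<in> I}" using I'.Icarr[OF q] by simp
    qed
    show "{q \<in> carrier ?N. \<rho> q \<in> I} \<subseteq> Idl\<^bsub>?N\<^esub> (\<rho>' ` F)"
    proof
      fix q assume q: "q \<in> {q \<in> carrier ?N. \<rho> q \<in> I}"
      have "\<rho>' (\<rho> q) \<in> Idl\<^bsub>?N\<^esub> (\<rho>' ` F)"
      proof (rule hom_kills_generated_ideal[OF P.is_cring N.ring_axioms \<rho>'(1) F(2) _ I'.is_ideal])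
        show "\<rho> q \<in> Idl\<^bsub>?P\<^esub> F" using q unfolding I_def by simp
        show "\<rho>' r \<in> Idl\<^bsub>?N\<^esub> (\<rho>' ` F)" if "r \<in> F" for r using N.genideal_self[OF F'] that by blast
      qed
      then show "q \<in> Idl\<^bsub>?N\<^esub> (\<rho>' ` F)" using \<rho>'\<rho> q by simp
    qed
  qed
  finally have "a_kernel ?N (?P Quot I) h = Idl\<^bsub>?N\<^esub> (\<rho>' ` F)" .
  then show ?thesis
    unfolding finitely_presented_def algebra_hom_def
    using h surj F' F(1) \<rho>(2) unfolding h_def
    by (intro exI[of _ n] exI[of _ "(+>\<^bsub>?P\<^esub>) I \<circ> \<rho>"] exI[of _ "\<rho>' ` F"]) auto
qed

text \<open>The substitution \<open>y\<close> splits \<open>P / I\<^sup>2 \<rightarrow> P / I\<close>; any lift of the coordinates to \<open>B\<close> sends \<open>I\<close>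
  into \<open>J\<close>, hence \<open>I\<^sup>2\<close> to \<open>0\<close>, so composing it with the splitting gives the required lift.\<close>

lemma formally_smooth_quotient:
  fixes F :: "('v, 'k::comm_ring_1) mpoly set" and y :: "'v \<Rightarrow> ('v, 'k) mpoly"
  assumes F: "F \<subseteq> carrier (mpoly_ring Vs)"
    and y: "\<And>v. v \<in> Vs \<Longrightarrow> y v - mpoly_var v \<in> regular.span F"
    and sq: "\<And>r. r \<in> F \<Longrightarrow> mpoly_eval (mpoly_ring UNIV) mpoly_const y r \<in> ideal_square (regular.span F)"
  defines "I \<equiv> Idl\<^bsub>mpoly_ring Vs\<^esub> F"
  shows "formally_smooth TYPE('b) (mpoly_ring Vs Quot I) (\<lambda>c. I +>\<^bsub>mpoly_ring Vs\<^esub> mpoly_const c)"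
  unfolding formally_smooth_def
proof (intro allI impI, elim conjE)
  let ?P = "mpoly_ring Vs :: ('v, 'k) mpoly ring" and ?U = "mpoly_ring UNIV :: ('v, 'k) mpoly ring"
  fix B :: "'b ring" and \<theta> J g
  assume alg: "is_algebra B \<theta>" and J: "ideal J B" and J2: "\<forall>x\<in>J. \<forall>y\<in>J. x \<otimes>\<^bsub>B\<^esub> y = \<zero>\<^bsub>B\<^esub>"
    and g: "g \<in> algebra_hom (?P Quot I) (\<lambda>c. I +>\<^bsub>?P\<^esub> mpoly_const c) (B Quot J) (\<lambda>c. J +>\<^bsub>B\<^esub> \<theta> c)"
  interpret P: cring ?P by (rule mpoly_ring_cring)
  interpret U: cring ?U by (rule mpoly_ring_cring)
  interpret I: ideal I ?P unfolding I_def using F by (rule P.genideal_ideal)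
  interpret B: cring B using alg unfolding is_algebra_def by simp
  interpret J: ideal J B by (rule J)
  have \<theta>: "\<theta> \<in> ring_hom base_ring B" using alg unfolding is_algebra_def by simp
  have gh: "g \<in> ring_hom (?P Quot I) (B Quot J)" and gc: "\<And>c. g (I +>\<^bsub>?P\<^esub> mpoly_const c) = J +>\<^bsub>B\<^esub> \<theta> c"
    using g unfolding algebra_hom_def by auto
  have "\<exists>b\<in>carrier B. v \<in> Vs \<longrightarrow> J +>\<^bsub>B\<^esub> b = g (I +>\<^bsub>?P\<^esub> mpoly_var v)" for v
  proof (cases "v \<in> Vs")
    case True
    have "g (I +>\<^bsub>?P\<^esub> mpoly_var v) \<in> carrier (B Quot J)"
      by (rule ring_hom_closed[OF gh ring_hom_closed[OF I.rcos_ring_hom mpoly_var_closed[OF True]]])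
    then show ?thesis unfolding FactRing_simps by auto
  qed (use B.zero_closed in blast)
  then obtain b where b: "\<And>v. b v \<in> carrier B" "\<And>v. v \<in> Vs \<Longrightarrow> J +>\<^bsub>B\<^esub> b v = g (I +>\<^bsub>?P\<^esub> mpoly_var v)"
    by metis
  define ev where "ev = mpoly_eval B \<theta> b"
  have ev: "ev \<in> ring_hom (mpoly_ring Ws) B" for Ws
    unfolding ev_def by (rule mpoly_eval_hom[OF B.is_cring \<theta> b(1)])
  have ev_const: "ev (mpoly_const c) = \<theta> c" for c
    unfolding ev_def by (rule mpoly_eval_const[OF B.is_cring \<theta> b(1)])
  have ev_var: "ev (mpoly_var v) = b v" for v
    unfolding ev_def by (rule mpoly_eval_var[OF B.is_cring \<theta> b(1)])
  have ev_cl: "ev p \<in> carrier B" and ev_add: "ev (p + q) = ev p \<oplus>\<^bsub>B\<^esub> ev q"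
    and ev_mult: "ev (p * q) = ev p \<otimes>\<^bsub>B\<^esub> ev q" for p q
    using ring_hom_closed[OF ev[of UNIV]] ring_hom_add[OF ev[of UNIV]] ring_hom_mult[OF ev[of UNIV]] by simp_all
  have ev_0: "ev 0 = \<zero>\<^bsub>B\<^esub>" using ring_hom_zero[OF ev[of UNIV] U.ring_axioms B.ring_axioms] by simp
  have ev_g: "J +>\<^bsub>B\<^esub> ev p = g (I +>\<^bsub>?P\<^esub> p)" if "p \<in> carrier ?P" for p
    using mpoly_hom_unique[OF ring_hom_trans[OF ev[of Vs] J.rcos_ring_hom] ring_hom_trans[OF I.rcos_ring_hom gh] _ _ that]
      gc b(2) ev_const ev_var by simp
  have FI: "F \<subseteq> I" unfolding I_def using F by (rule P.genideal_self)
  have evF: "ev r \<in> J" if r: "r \<in> F" for r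
  proof -
    have "J +>\<^bsub>B\<^esub> ev r = g (I +>\<^bsub>?P\<^esub> r)" using ev_g F r by blast
    also have "I +>\<^bsub>?P\<^esub> r = \<zero>\<^bsub>?P Quot I\<^esub>"
      using P.a_rcos_zero[OF I.is_ideal] FI r unfolding FactRing_def by auto
    also have "g \<dots> = \<zero>\<^bsub>B Quot J\<^esub>" by (rule ring_hom_zero[OF gh I.quotient_is_ring J.quotient_is_ring])
    finally have "J +>\<^bsub>B\<^esub> ev r = J" unfolding FactRing_def by simp
    then show ?thesis by (rule J.rcos_const_imp_mem[OF ev_cl])
  qed
  \<comment> \<open>The substitution \<open>y\<close> may involve variables outside
    \<open>Vs\<close>, since its corrections lie in the span of \<open>F\<close> in the full
    polynomial ring. Hence \<open>ev\<close> has to send this whole span into \<open>J\<close>, not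
    only \<open>I\<close>.\<close>
  have "regular.subspace {p. ev p \<in> J}"
    by (rule regular.subspaceI) (auto simp: ev_0 ev_add ev_mult ev_cl J.I_l_closed J.zero_closed J.a_closed)
  then have evI: "ev p \<in> J" if "p \<in> regular.span F" for p
    using regular.span_minimal[of F "{p. ev p \<in> J}"] evF that by blast
  have "regular.subspace {p. ev p = \<zero>\<^bsub>B\<^esub>}"
    by (rule regular.subspaceI) (auto simp: ev_0 ev_add ev_mult ev_cl)
  moreover have "{p * q |p q. p \<in> regular.span F \<and> q \<in> regular.span F} \<subseteq> {p. ev p = \<zero>\<^bsub>B\<^esub>}"
    using evI J2 ev_mult by auto
  ultimately have evI2: "ev p = \<zero>\<^bsub>B\<^esub>" if "p \<in> ideal_square (regular.span F)" for p
    using regular.span_minimal that unfolding ideal_square_def by blast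
  define sub where "sub = mpoly_eval ?U mpoly_const y"
  have yU: "y v \<in> carrier ?U" for v by simp
  have sub: "sub \<in> ring_hom (mpoly_ring Ws) ?U" for Ws
    unfolding sub_def by (rule mpoly_eval_hom[OF U.is_cring mpoly_const_hom yU])
  have sub_const: "sub (mpoly_const c) = mpoly_const c" for c
    unfolding sub_def by (rule mpoly_eval_const[OF U.is_cring mpoly_const_hom yU])
  have sub_var: "sub (mpoly_var v) = y v" for v
    unfolding sub_def by (rule mpoly_eval_var[OF U.is_cring mpoly_const_hom yU])
  have h0: "ev \<circ> sub \<in> ring_hom ?P B" by (rule ring_hom_trans[OF sub ev])
  have kill: "(ev \<circ> sub) p = \<zero>\<^bsub>B\<^esub>" if "p \<in> I" for p
  proof -
    have "(ev \<circ> sub) r \<in> {\<zero>\<^bsub>B\<^esub>}" if "r \<in> F" for r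
      using evI2[OF sq[OF that]] unfolding sub_def by simp
    then have "(ev \<circ> sub) p \<in> {\<zero>\<^bsub>B\<^esub>}"
      using hom_kills_generated_ideal[OF P.is_cring B.ring_axioms h0 F _ B.zeroideal] \<open>p \<in> I\<close>
      unfolding I_def by blast
    then show ?thesis by simp
  qed
  obtain h where h: "h \<in> ring_hom (?P Quot I) B" "\<And>p. p \<in> carrier ?P \<Longrightarrow> h (I +>\<^bsub>?P\<^esub> p) = (ev \<circ> sub) p"
    using quotient_hom_factor[OF P.ring_axioms I.is_ideal B.ring_axioms h0 kill] by blast
  have lift: "J +>\<^bsub>B\<^esub> (ev \<circ> sub) p = g (I +>\<^bsub>?P\<^esub> p)" if p: "p \<in> carrier ?P" for p
  proof -
    have "((+>\<^bsub>B\<^esub>) J \<circ> (ev \<circ> sub)) p = (g \<circ> (+>\<^bsub>?P\<^esub>) I) p"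
    proof (rule mpoly_hom_unique[OF ring_hom_trans[OF h0 J.rcos_ring_hom] ring_hom_trans[OF I.rcos_ring_hom gh] _ _ p])
      show "((+>\<^bsub>B\<^esub>) J \<circ> (ev \<circ> sub)) (mpoly_const c) = (g \<circ> (+>\<^bsub>?P\<^esub>) I) (mpoly_const c)" for c
        using gc by (simp add: sub_const ev_const)
      show "((+>\<^bsub>B\<^esub>) J \<circ> (ev \<circ> sub)) (mpoly_var v) = (g \<circ> (+>\<^bsub>?P\<^esub>) I) (mpoly_var v)" if v: "v \<in> Vs" for v
      proof -
        have "ev (y v) = ev (y v - mpoly_var v) \<oplus>\<^bsub>B\<^esub> b v"
          using ev_add[of "y v - mpoly_var v" "mpoly_var v"] ev_var[of v] by simp
        then have "ev (y v) \<ominus>\<^bsub>B\<^esub> b v = ev (y v - mpoly_var v)"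
          using b(1) ev_cl by (simp add: B.minus_eq B.a_assoc B.r_neg)
        then have "ev (y v) \<ominus>\<^bsub>B\<^esub> b v \<in> J" using evI[OF y[OF v]] by simp
        then have "J +>\<^bsub>B\<^esub> ev (y v) = J +>\<^bsub>B\<^esub> b v"
          using B.quotient_eq_iff_same_a_r_cos[OF J ev_cl b(1)] by blast
        then show ?thesis using b(2)[OF v] by (simp add: sub_var)
      qed
    qed
    then show ?thesis by simp
  qed
  show "\<exists>h\<in>algebra_hom (?P Quot I) (\<lambda>c. I +>\<^bsub>?P\<^esub> mpoly_const c) B \<theta>.
      \<forall>a\<in>carrier (?P Quot I). J +>\<^bsub>B\<^esub> h a = g a"
  proof (intro bexI[of _ h] ballI)
    show "h \<in> algebra_hom (?P Quot I) (\<lambda>c. I +>\<^bsub>?P\<^esub> mpoly_const c) B \<theta>"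
      unfolding algebra_hom_def using h by (simp add: sub_const ev_const)
    fix X assume "X \<in> carrier (?P Quot I)"
    then obtain p where p: "p \<in> carrier ?P" "X = I +>\<^bsub>?P\<^esub> p" unfolding FactRing_simps by auto
    then show "J +>\<^bsub>B\<^esub> h X = g X" using h(2) lift by simp
  qed
qed

section \<open>Smoothness of the varieties\<close>

lemma relations_closed:
  assumes T: "tree V E"
  shows "relations V E \<phi> M \<alpha> \<subseteq> carrier (mpoly_ring (coords V E \<phi> M))"
proof -
  let ?P = "carrier (mpoly_ring (coords V E \<phi> M))"
  have "mpoly_var (Xvar i) \<in> ?P" "mpoly_var (Xvar' i) \<in> ?P" if "i \<in> V" for i
    using that by (auto intro!: mpoly_var_closed simp: coords_def)
  moreover have "mpoly_var (Alpha i) \<in> ?P" "mpoly_var (AlphaInv i) \<in> ?P" if "i \<in> versal_uncovered V E \<phi> M" for i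
    using that by (auto intro!: mpoly_var_closed simp: coords_def)
  moreover have "neighbors E i \<subseteq> V" for i
    using edge_in_vertices(1)[OF T] unfolding neighbors_def by blast
  moreover have "coefficient V E \<phi> M \<alpha> i \<in> ?P" for i
    unfolding coefficient_def by (auto intro: mpoly_var_closed simp: coords_def)
  ultimately show ?thesis
    unfolding relations_def
    by (fastforce intro!: mpoly_ring_diff_closed mpoly_ring_add_closed mpoly_ring_mult_closed
        mpoly_ring_one_closed mpoly_ring_prod_closed)
qed

theorem theorem3p1:
  fixes V :: "'a set" and E M :: "'a set set"
    and \<phi> :: "'a set \<Rightarrow> component_type" and \<alpha> :: "'a \<Rightarrow> 'k::field"
  assumes "tree V E"
    and "maximum_matching E M"
    and "\<And>C u. C \<in> red_green_components V E \<Longrightarrow> \<phi> C = Generic \<Longrightarrow> u \<in> C \<Longrightarrow> u \<notin> \<Union>M \<Longrightarrow> \<alpha> u \<noteq> 0"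
    and "\<And>C. C \<in> red_green_components V E \<Longrightarrow> \<phi> C = Generic \<Longrightarrow> genericity_condition V E M \<alpha> C"
  shows "smooth_algebra TYPE('b) (coordinate_ring V E \<phi> M \<alpha>) (structure_map V E \<phi> M \<alpha>)"
proof -
  note T = assms(1) and M = assms(2)
  define U where "U = versal_uncovered V E \<phi> M"
  define F where "F = relations V E \<phi> M \<alpha>"
  \<comment> \<open>The ideal generated in the polynomial ring on all of \<open>'a coord\<close>,
    which is where the Newton corrections live.\<close>
  define I where "I = regular.span F"
  define x :: "'a \<Rightarrow> ('a coord, 'k) mpoly" where "x i = mpoly_var (Xvar i)" for i
  define x' :: "'a \<Rightarrow> ('a coord, 'k) mpoly" where "x' i = mpoly_var (Xvar' i)" for i
  define a where "a = coefficient V E \<phi> M \<alpha>"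
  have finV: "finite V" using T unfolding tree_def simple_graph_def by simp
  have UV: "U \<subseteq> V" unfolding U_def versal_uncovered_def by auto
  have F_vertex: "x i * x' i - (1 + a i * prod x (neighbors E i)) \<in> F" if "i \<in> V" for i
    using that unfolding F_def relations_def x_def x'_def a_def by blast
  have F_unit: "mpoly_var (Alpha i) * mpoly_var (AlphaInv i) - 1 \<in> F" if "i \<in> U" for i
    using that unfolding F_def relations_def U_def by blast
  have F_cases: "(\<exists>i\<in>V. f = x i * x' i - (1 + a i * prod x (neighbors E i))) \<or>
      (\<exists>i\<in>U. f = mpoly_var (Alpha i) * mpoly_var (AlphaInv i) - 1)" if "f \<in> F" for f
    using that unfolding F_def relations_def x_def x'_def a_def U_def by blast
  have I: "regular.subspace I" unfolding I_def by (rule regular.subspace_span)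
  have FI: "f \<in> I" if "f \<in> F" for f unfolding I_def using that by (rule regular.span_base)
  \<comment> \<open>\<open>I\<close> also contains the relations
    \<open>Alpha i * AlphaInv i - 1\<close>, but only the vertex relations enter the Jacobian;
    \<open>AlphaInv i\<close> is corrected once \<open>b i\<close> is known.\<close>
  interpret vertex_system V U "neighbors E" x x' a I
  proof
    show "neighbors E i \<subseteq> V" for i using edge_in_vertices(1)[OF T] unfolding neighbors_def by blast
    show "i \<in> neighbors E j" if "j \<in> neighbors E i" for i j
      using that edge_commute[of i j E] unfolding neighbors_def by simp
  qed (use finV I FI F_vertex in auto)
  have "\<forall>i\<in>V. in_image (unit_vec i)"
  proof (rule ccontr)
    assume "\<not> ?thesis"
    then obtain m S where m: "prime_ideal m" and S: "S \<noteq> {}" "S \<subseteq> V - U"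
      and rel: "\<And>i. i \<in> S \<Longrightarrow> a i * prod x (neighbors E i) + 1 \<in> m"
      and two: "\<And>i j. i \<in> S \<Longrightarrow> j \<in> neighbors E i \<Longrightarrow> \<exists>i'\<in>S. i' \<noteq> i \<and> j \<in> neighbors E i'"
      by (rule obstruction_to_surjectivity) blast
    have SV: "S \<subseteq> V" using S by blast
    have two': "\<exists>i'\<in>S. i' \<noteq> i \<and> {i', j} \<in> E" if i: "i \<in> S" and e: "{i, j} \<in> E" for i j
    proof -
      have "j \<in> neighbors E i" using e edge_commute[of i j E] unfolding neighbors_def by simp
      then obtain i' where "i' \<in> S" "i' \<noteq> i" "j \<in> neighbors E i'" using two[OF i] by blast
      then show ?thesis using edge_commute[of j i' E] unfolding neighbors_def by auto
    qed
    note alt = alternating_path_to_uncovered[OF T M SV two']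
    obtain r where r: "r \<in> S" using S by blast
    define C where "C = {w. (r, w) \<in> (red_green_adj V E)\<^sup>*}"
    have Sred: "S \<subseteq> red V E" using alt(1) by blast
    then have C: "C \<in> red_green_components V E"
      using r unfolding C_def red_green_components_def by blast
    have generic: "\<phi> C = Generic"
    proof (rule ccontr)
      assume "\<phi> C \<noteq> Generic"
      then have versal: "\<phi> C = Versal" by (cases "\<phi> C") auto
      obtain u where u: "u \<in> S" "u \<notin> \<Union>M" "u \<in> C" using alt(2)[OF _ _ r] unfolding C_def by blast
      then have "u \<in> U" using SV versal C unfolding U_def versal_uncovered_def by blast
      then show False using u S by blast
    qed
    obtain S' \<epsilon> where S': "S' \<subseteq> S" "admissible V E C S'" "admissible_signs V E S' \<epsilon>"
      using admissible_exists[OF T Sred two' r] unfolding C_def by blast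
    have "(\<Prod>i\<in>S'. param M \<alpha> i powi \<epsilon> i) = (- 1) ^ card S'"
    proof (rule admissible_product[OF T C S'(2,3) m, where \<iota> = mpoly_const and x = x])
      fix i assume "i \<in> S'"
      then have "i \<in> S" "i \<notin> U" using S' S by auto
      then have "a i = mpoly_const (param M \<alpha> i)" unfolding a_def coefficient_def U_def by simp
      then show "mpoly_const (param M \<alpha> i) * prod x (neighbors E i) + 1 \<in> m"
        using rel[OF \<open>i \<in> S\<close>] by simp
    qed (simp_all add: mpoly_const_1 mpoly_const_mult mpoly_const_add)
    then show False
      using assms(4)[OF C generic] S'(2,3) unfolding genericity_condition_def by blast
  qed
  then obtain y y' b where xI: "\<And>i. y i - x i \<in> I" and x'I: "\<And>i. y' i - x' i \<in> I"
    and aI: "\<And>i. b i - a i \<in> I" and ba: "\<And>i. i \<notin> U \<Longrightarrow> b i = a i"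
    and sol: "\<And>i. i \<in> V \<Longrightarrow> y i * y' i - (1 + b i * prod y (neighbors E i)) \<in> ideal_square I"
    by (rule newton_step) blast
  define s :: "'a \<Rightarrow> ('a coord, 'k) mpoly" where "s i = mpoly_var (Alpha i) * mpoly_var (AlphaInv i) - 1" for i
  \<comment> \<open>one Newton step for the inverse: \<open>b i * AlphaInv i = 1 + z i\<close> and \<open>(1 + z i) * (1 - z i) = 1 - (z i)\<^sup>2\<close>\<close>
  define z where "z i = s i + mpoly_var (AlphaInv i) * (b i - a i)" for i
  define Y where "Y v = (case v of Xvar i \<Rightarrow> y i | Xvar' i \<Rightarrow> y' i | Alpha i \<Rightarrow> b i
      | AlphaInv i \<Rightarrow> mpoly_var (AlphaInv i) - mpoly_var (AlphaInv i) * z i)" for v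
  define sub where "sub = mpoly_eval (mpoly_ring UNIV) mpoly_const Y"
  have aU: "a i = mpoly_var (Alpha i)" if "i \<in> U" for i using that unfolding a_def coefficient_def U_def by simp
  have zI: "z i \<in> I" if "i \<in> U" for i
    unfolding z_def s_def using FI[OF F_unit[OF that]] aI I
    by (intro regular.subspace_add regular.subspace_scale) auto
  have YI: "Y v - mpoly_var v \<in> I" if "v \<in> coords V E \<phi> M" for v
  proof (cases v)
    case (Alpha i)
    then have "i \<in> U" using that unfolding coords_def U_def by auto
    then show ?thesis using aI[of i] aU Alpha unfolding Y_def by simp
  next
    case (AlphaInv i)
    then have "i \<in> U" using that unfolding coords_def U_def by auto
    then show ?thesis using regular.subspace_scale[OF I zI, of i "- mpoly_var (AlphaInv i)"] AlphaInv unfolding Y_def by simp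
  qed (use xI x'I in \<open>simp_all add: Y_def x_def x'_def\<close>)
  interpret Un: cring "mpoly_ring UNIV :: ('a coord, 'k) mpoly ring" by (rule mpoly_ring_cring)
  have YU: "Y v \<in> carrier (mpoly_ring UNIV)" for v by simp
  have hom: "sub \<in> ring_hom (mpoly_ring UNIV) (mpoly_ring UNIV)"
    unfolding sub_def by (rule mpoly_eval_hom[OF Un.is_cring mpoly_const_hom YU])
  have sub_const: "sub (mpoly_const c) = mpoly_const c" for c
    unfolding sub_def by (rule mpoly_eval_const[OF Un.is_cring mpoly_const_hom YU])
  have sub_var: "sub (mpoly_var v) = Y v" for v
    unfolding sub_def by (rule mpoly_eval_var[OF Un.is_cring mpoly_const_hom YU])
  have sub_mult: "sub (p * q) = sub p * sub q" and sub_add: "sub (p + q) = sub p + sub q" and sub_1: "sub 1 = 1" for p q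
    using ring_hom_mult[OF hom] ring_hom_add[OF hom] ring_hom_one[OF hom] by simp_all
  have sub_diff: "sub (p - q) = sub p - sub q" for p q
    using sub_add[of "p - q" q] by (simp add: algebra_simps)
  have sub_prod: "sub (prod f A) = (\<Prod>i\<in>A. sub (f i))" for f :: "'a \<Rightarrow> _" and A
    by (induction A rule: infinite_finite_induct) (simp_all add: sub_1 sub_mult)
  have sub_a: "sub (a i) = b i" for i
  proof (cases "i \<in> U")
    case True
    then show ?thesis by (simp add: aU sub_var Y_def)
  next
    case False
    then have "a i = mpoly_const (param M \<alpha> i)" unfolding a_def coefficient_def U_def by simp
    then show ?thesis using ba[OF False] sub_const by simp
  qed
  have sq: "sub f \<in> ideal_square I" if "f \<in> F" for f
    using F_cases[OF that]
  proof (elim disjE bexE)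
    fix i assume "i \<in> V" "f = x i * x' i - (1 + a i * prod x (neighbors E i))"
    then show ?thesis
      using sol[of i]
      by (simp add: sub_diff sub_add sub_mult sub_prod sub_1 sub_a) (simp add: x_def x'_def sub_var Y_def)
  next
    fix i assume i: "i \<in> U" and f: "f = mpoly_var (Alpha i) * mpoly_var (AlphaInv i) - 1"
    let ?A = "mpoly_var (Alpha i) :: ('a coord, 'k) mpoly" and ?B = "mpoly_var (AlphaInv i) :: ('a coord, 'k) mpoly"
    have "sub f = b i * (?B - ?B * z i) - 1"
      unfolding f by (simp add: sub_diff sub_mult sub_1 sub_var Y_def)
    also have "\<dots> = - (z i * z i)"
    proof -
      have "b i * ?B = 1 + z i" unfolding z_def s_def aU[OF i] by (simp add: algebra_simps)
      moreover have "b i * (?B - ?B * z i) = b i * ?B * (1 - z i)" by (simp add: algebra_simps)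
      ultimately show ?thesis by (simp add: algebra_simps)
    qed
    also have "\<dots> \<in> ideal_square I"
      by (rule regular.subspace_neg[OF ideal_square_subspace ideal_square_mult[OF zI[OF i] zI[OF i]]])
    finally show ?thesis .
  qed
  have coords: "finite (coords V E \<phi> M)"
    using finV finite_subset[OF UV finV] unfolding coords_def U_def by simp
  have finF: "finite F"
  proof -
    have "F \<subseteq> (\<lambda>i. x i * x' i - (1 + a i * prod x (neighbors E i))) ` V
        \<union> (\<lambda>i. mpoly_var (Alpha i) * mpoly_var (AlphaInv i) - 1) ` U"
      using F_cases by blast
    then show ?thesis using finV finite_subset[OF UV finV] by (meson finite_Un finite_imageI finite_subset)
  qed
  have FP: "F \<subseteq> carrier (mpoly_ring (coords V E \<phi> M))" unfolding F_def by (rule relations_closed[OF T])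
  have "formally_smooth TYPE('b) (mpoly_ring (coords V E \<phi> M) Quot Idl\<^bsub>mpoly_ring (coords V E \<phi> M)\<^esub> F)
      (\<lambda>c. Idl\<^bsub>mpoly_ring (coords V E \<phi> M)\<^esub> F +>\<^bsub>mpoly_ring (coords V E \<phi> M)\<^esub> mpoly_const c)"
    using YI sq unfolding I_def sub_def by (rule formally_smooth_quotient[OF FP])
  then show ?thesis
    using is_algebra_quotient[OF FP] finitely_presented_quotient[OF coords finF FP]
    unfolding smooth_algebra_def coordinate_ring_def structure_map_def Let_def F_def by blast
qed

end
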